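(* Let $G$ be a finite group and let $p$ be an odd prime divisor of the order of $G$. Let $H$ be a cyclic subgroup of order $p$ of $G$. If $\langle H, H^g\rangle \cap N_G(H) = H$ for all $g \in G$, then $\langle H^G\rangle \cap N_G(H) = H$. In particular, $G = N_G(H)\, O_{p'}(G)$.
   Context: For a subgroup $H$ of $G$ and $g\in G$, $H^g = g^{-1}Hg$; $N_G(H)$ is the normalizer of $H$ in $G$; $\langle H^G\rangle$ is the normal closure of $H$ in $G$; $O_{p'}(G)$ is the largest normal subgroup of $G$ of order not divisible by $p$. *)

theory Defs
  imports "HOL-Algebra.Algebra" "HOL-Computational_Algebra.Primes"
begin

(* The conjugate H^g = g^(-1) H g. *)
definition conjugate :: "('a, 'b) monoid_scheme \<Rightarrow> 'a set \<Rightarrow> 'a \<Rightarrow> 'a set" where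
  "conjugate G H g = inv\<^bsub>G\<^esub> g <#\<^bsub>G\<^esub> H #>\<^bsub>G\<^esub> g"

definition normal_closure :: "('a, 'b) monoid_scheme \<Rightarrow> 'a set \<Rightarrow> 'a set" where
  "normal_closure G H = generate G (\<Union>g\<in>carrier G. conjugate G H g)"

(* The subgroup O_{p'}(G).  GREATEST refers to inclusion, and a greatest such subgroup exists
   when G is finite and p is prime, see p_prime_core_greatest below.  The order of an infinite
   subgroup is 0, which p divides. *)
definition p_prime_core :: "nat \<Rightarrow> ('a, 'b) monoid_scheme \<Rightarrow> 'a set" where
  "p_prime_core p G = (GREATEST N. N \<lhd> G \<and> \<not> p dvd card N)"

lemma (in group) card_set_mult_dvd:
  assumes "M \<lhd> G" "subgroup N G"
  shows "card (M <#> N) dvd card M * card N"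
proof -
  interpret second_isomorphism_grp M G N
    using assms by (simp add: second_isomorphism_grp.intro second_isomorphism_grp_axioms.intro)
  let ?K = "G\<lparr>carrier := M <#> N\<rparr>" and ?S = "G\<lparr>carrier := N\<rparr>"
  have gK: "group ?K" and gS: "group ?S"
    using subgroup_imp_group[OF normal_set_mult_subgroup] subgroup_imp_group[OF assms(2)] by auto
  have "card (carrier (?S Mod (M \<inter> N))) = card (carrier (?K Mod M))"
    using normal_intersection_quotient_isom bij_betw_same_card unfolding iso_def by blast
  then have eq: "card (rcosets\<^bsub>?S\<^esub> (M \<inter> N)) = card (rcosets\<^bsub>?K\<^esub> M)"
    by (simp add: FactGroup_def)
  have "subgroup M ?K"
    by (simp add: H_contained_in_set_mult normal_restrict_supergroup normal_set_mult_subgroup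
        normal_axioms normal_imp_subgroup)
  then have "card (M <#> N) = card (rcosets\<^bsub>?K\<^esub> M) * card M"
    using group.lagrange[OF gK] by (simp add: order_def)
  moreover have "subgroup (M \<inter> N) ?S"
    using normal_subgrp_intersection_normal normal_imp_subgroup by (simp add: Int_commute)
  then have "card N = card (rcosets\<^bsub>?S\<^esub> (M \<inter> N)) * card (M \<inter> N)"
    using group.lagrange[OF gS] by (simp add: order_def)
  ultimately show ?thesis
    unfolding eq by simp
qed

lemma (in group) p_prime_core_greatest:
  assumes fin: "finite (carrier G)" and p: "Factorial_Ring.prime p"
  shows p_prime_core_normal: "p_prime_core p G \<lhd> G"
    and not_dvd_card_p_prime_core: "\<not> p dvd card (p_prime_core p G)"
    and p_prime_core_max: "\<And>M. M \<lhd> G \<Longrightarrow> \<not> p dvd card M \<Longrightarrow> M \<subseteq> p_prime_core p G"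
proof -
  let ?P = "\<lambda>N. N \<lhd> G \<and> \<not> p dvd card N"
  have sub: "N \<subseteq> carrier G" if "N \<lhd> G" for N
    using that normal_imp_subgroup subgroup.subset by blast
  have "?P {\<one>}"
    using p one_is_normal by (auto simp: prime_nat_iff)
  moreover have "finite {N. ?P N}"
    using fin sub by (auto intro: finite_subset[of _ "Pow (carrier G)"])
  ultimately obtain N where N: "?P N" and mx: "\<And>M. ?P M \<Longrightarrow> N \<subseteq> M \<Longrightarrow> M = N"
    using finite_has_maximal[of "{N. ?P N}"] by blast
  have sN: "subgroup N G"
    using N normal_imp_subgroup by blast
  have le: "M \<subseteq> N" if M: "?P M" for M
  proof -
    interpret second_isomorphism_grp M G N
      using M sN
      by (simp add: second_isomorphism_grp.intro second_isomorphism_grp_axioms.intro)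
    have "\<not> p dvd card M * card N"
      using M N p by (simp add: prime_dvd_mult_iff)
    then have "?P (M <#> N)"
      using card_set_mult_dvd[of M N] M N sN normal_subgroup_set_mult_closed dvd_trans
      by blast
    then show ?thesis
      using mx S_contained_in_set_mult H_contained_in_set_mult by blast
  qed
  have "p_prime_core p G = N"
    unfolding p_prime_core_def by (rule Greatest_equality) (use N le in auto)
  then show "p_prime_core p G \<lhd> G" "\<not> p dvd card (p_prime_core p G)"
    "\<And>M. M \<lhd> G \<Longrightarrow> \<not> p dvd card M \<Longrightarrow> M \<subseteq> p_prime_core p G"
    using N le by auto
qed

end

theory Submission
  imports Defs
begin

text \<open>
Let \<open>D\<close> be the class of conjugates of \<open>H\<close> and \<open>T\<close> the set of their nontrivial elements.  If
\<open>A, B \<in> D\<close>, then \<open>A\<close> is self-normalizing of prime order in \<open>K = \<langle>A, B\<rangle>\<close>, so the transfer of \<open>K\<close>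
into \<open>A\<close> splits: \<open>K = A N\<close> with a normal complement \<open>N\<close> of order prime to \<open>p\<close>, and counting
conjugates of \<open>A\<close> shows that \<open>K - N\<close> lies in \<open>T\<close> while \<open>N\<close> avoids \<open>T\<close> (lemma
\<open>frobenius_kernel\<close>).  A left coset of \<open>A\<close> in \<open>K\<close> meets \<open>N\<close> exactly once.  Hence
for every \<open>f \<in> T\<close> and every \<open>A \<in> D\<close> exactly one element of \<open>f A\<close> lies outside \<open>T\<close>
(lemma \<open>coset_meets_T\<close>).

Put \<open>Z = {g. g T \<subseteq> T}\<close>, a normal subgroup that is disjoint from \<open>T\<close>.  Everything reduces to
the claim \<open>T T \<subseteq> T \<union> Z\<close>: it gives \<open>T \<subseteq> Z A\<close> for each \<open>A \<in> D\<close>, no nontrivial element of \<open>Z\<close>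
commutes with a nontrivial element of \<open>H\<close>, so \<open>\<langle>H\<^sup>G\<rangle> = Z H\<close> meets the normalizer of \<open>H\<close> only in
\<open>H\<close>, the order of \<open>Z\<close> is prime to \<open>p\<close>, and \<open>Z\<close> permutes \<open>D\<close> transitively, which is the Frattini
factorization.

For \<open>p \<ge> 5\<close> the claim follows by counting, since \<open>T\<close> is almost closed under
multiplication.  With \<open>n\<close> the number of members of \<open>D\<close>, each \<open>g \<in> T\<close> moves only \<open>n\<close> of the
\<open>n (p - 1)\<close> elements of \<open>T\<close> out of \<open>T\<close>.  A product of three elements of \<open>T\<close> moves at most \<open>3 n\<close>
of them, so it maps some element of \<open>T\<close> into \<open>T\<close> and therefore is a product of two.  Thus \<open>T T\<close> is
a subgroup.  Double counting together with the divisibility of its order by \<open>n p\<close> leaves only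
\<open>n\<close> elements outside \<open>T\<close>, and all of these are in \<open>Z\<close> (lemma \<open>products_large_prime\<close>).

For \<open>p = 3\<close> the bound \<open>3 n\<close> is too weak, and the structure of a Frobenius kernel with a complement
of order three takes over: an element of the kernel commutes with its conjugates under the
complement, and the product of the three conjugates is trivial.  The condition on cosets now says that
of \<open>f y\<close> and \<open>f y\<^sup>-\<^sup>1\<close> exactly one is in \<open>T\<close>.  If \<open>V\<close> is an abelian invariant subgroup of the
kernel for \<open>x \<in> T\<close>, it follows that \<open>{v \<in> V. z v \<in> T}\<close> is a subgroup of index at most two
for every \<open>z \<in> T\<close> (lemma \<open>stabilizer_homomorphism\<close>).  So membership of \<open>t v\<close> in \<open>T\<close> is a
bilinear pairing with values in the field of two elements, for \<open>t\<close> and \<open>v\<close> in two such subgroups.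
If the pairing were nonzero, invariance under \<open>x\<close> would produce \<open>w\<^sub>1, w\<^sub>2 \<in> T\<close> with neither
\<open>w\<^sub>1 w\<^sub>2\<close> nor \<open>w\<^sub>1 w\<^sub>2\<^sup>-\<^sup>1\<close> in \<open>T\<close> (lemma \<open>pairing_trivial\<close>).  So it vanishes, and that is the
claim.
\<close>

section \<open>Conjugation, centralizers and subgroups of prime order\<close>

context group
begin

lemma inv_mult_cancel_left:
  assumes "a \<in> carrier G" "b \<in> carrier G"
  shows "inv a \<otimes> (a \<otimes> b) = b" and "a \<otimes> (inv a \<otimes> b) = b"
  using assms by (simp_all add: m_assoc [symmetric])

lemmas group_word = m_assoc inv_mult_group inv_mult_cancel_left

lemma subgroup_card_dvd:
  assumes A: "subgroup A G" and B: "subgroup B G" and AB: "A \<subseteq> B"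
  shows "card A dvd card B"
proof -
  have "card (rcosets\<^bsub>G\<lparr>carrier := B\<rparr>\<^esub> A) * card A = card B"
    using group.lagrange[OF subgroup_imp_group[OF B] subgroup_incl[OF A B AB]] by (simp add: order_def)
  then show ?thesis
    by (metis dvd_triv_right)
qed

text \<open>
\<open>A \<inter> B\<close> is a nontrivial subgroup of the group \<open>A\<close> of prime order, so Lagrange's theorem leaves only
\<open>A\<close> itself.
\<close>
lemma prime_order_subset:
  assumes A: "subgroup A G" and p: "Factorial_Ring.prime (card A)" and B: "subgroup B G"
    and a: "a \<in> A" "a \<in> B" "a \<noteq> \<one>"
  shows "A \<subseteq> B"
proof -
  have finA: "finite A"
    using p by (metis card.infinite not_prime_0)
  have "card (A \<inter> B) dvd card A"
    by (rule subgroup_card_dvd[OF subgroups_Inter_pair[OF A B] A]) blast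
  then have "card (A \<inter> B) = 1 \<or> card (A \<inter> B) = card A"
    using p by (auto simp: prime_nat_iff)
  moreover have "card (A \<inter> B) \<noteq> 1"
    using a subgroup.one_closed[OF A] subgroup.one_closed[OF B] by (metis IntI card_1_singletonE singletonD)
  ultimately have "A \<inter> B = A"
    using finA by (intro card_subset_eq) auto
  then show ?thesis
    by blast
qed

lemma centralizer_subgroup:
  assumes "U \<subseteq> carrier G"
  shows "subgroup {g \<in> carrier G. \<forall>u\<in>U. u \<otimes> g = g \<otimes> u} G"
proof (rule subgroupI)
  show "{g \<in> carrier G. \<forall>u\<in>U. u \<otimes> g = g \<otimes> u} \<noteq> {}"
    using assms by (force intro: exI[of _ \<one>])
next
  fix g assume "g \<in> {g \<in> carrier G. \<forall>u\<in>U. u \<otimes> g = g \<otimes> u}"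
  then have g: "g \<in> carrier G" "\<And>u. u \<in> U \<Longrightarrow> u \<otimes> g = g \<otimes> u"
    by auto
  have "u \<otimes> inv g = inv g \<otimes> u" if u: "u \<in> U" for u
  proof -
    have uG: "u \<in> carrier G"
      using assms u by blast
    have "u \<otimes> inv g = inv g \<otimes> (g \<otimes> u) \<otimes> inv g"
      using uG g(1) by (simp add: group_word)
    also have "\<dots> = inv g \<otimes> u"
      unfolding g(2)[OF u, symmetric] using uG g(1) by (simp add: group_word)
    finally show ?thesis .
  qed
  then show "inv g \<in> {g \<in> carrier G. \<forall>u\<in>U. u \<otimes> g = g \<otimes> u}"
    using g(1) by simp
next
  fix g h assume "g \<in> {g \<in> carrier G. \<forall>u\<in>U. u \<otimes> g = g \<otimes> u}"
    and "h \<in> {g \<in> carrier G. \<forall>u\<in>U. u \<otimes> g = g \<otimes> u}"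
  then have gh: "g \<in> carrier G" "h \<in> carrier G"
    "\<And>u. u \<in> U \<Longrightarrow> u \<otimes> g = g \<otimes> u" "\<And>u. u \<in> U \<Longrightarrow> u \<otimes> h = h \<otimes> u"
    by auto
  have "u \<otimes> (g \<otimes> h) = g \<otimes> h \<otimes> u" if "u \<in> U" for u
    using gh that assms by (metis m_assoc subsetD)
  then show "g \<otimes> h \<in> {g \<in> carrier G. \<forall>u\<in>U. u \<otimes> g = g \<otimes> u}"
    using gh(1,2) by simp
qed auto

text \<open>
The centralizer of a nontrivial \<open>a\<close> meets \<open>A\<close> nontrivially and therefore contains it.
\<close>
lemma prime_order_commute:
  assumes A: "subgroup A G" and p: "Factorial_Ring.prime (card A)" and ab: "a \<in> A" "b \<in> A"
  shows "a \<otimes> b = b \<otimes> a"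
proof (cases "a = \<one>")
  case True
  then show ?thesis
    using subgroup.mem_carrier[OF A ab(2)] by simp
next
  case False
  have aG: "a \<in> carrier G"
    using subgroup.mem_carrier[OF A ab(1)] .
  have "A \<subseteq> {g \<in> carrier G. \<forall>u\<in>{a}. u \<otimes> g = g \<otimes> u}"
    using prime_order_subset[OF A p centralizer_subgroup[of "{a}"], of a] ab False aG by simp
  then show ?thesis
    using ab by blast
qed

lemma conjugate_subgroup:
  assumes A: "subgroup A G" and g: "g \<in> carrier G"
  shows "subgroup ((\<lambda>a. inv g \<otimes> a \<otimes> g) ` A) G"
proof -
  interpret A: subgroup A G by (rule A)
  show ?thesis
  proof (rule subgroupI)
    show "(\<lambda>a. inv g \<otimes> a \<otimes> g) ` A \<subseteq> carrier G"
      using g by auto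
    show "(\<lambda>a. inv g \<otimes> a \<otimes> g) ` A \<noteq> {}"
      using A.one_closed by blast
  next
    fix c assume "c \<in> (\<lambda>a. inv g \<otimes> a \<otimes> g) ` A"
    then obtain a where a: "a \<in> A" "c = inv g \<otimes> a \<otimes> g"
      by blast
    then have "inv c = inv g \<otimes> inv a \<otimes> g"
      using g by (simp add: group_word)
    then show "inv c \<in> (\<lambda>a. inv g \<otimes> a \<otimes> g) ` A"
      using a by blast
  next
    fix c d assume "c \<in> (\<lambda>a. inv g \<otimes> a \<otimes> g) ` A" "d \<in> (\<lambda>a. inv g \<otimes> a \<otimes> g) ` A"
    then obtain a b where a: "a \<in> A" "c = inv g \<otimes> a \<otimes> g" and b: "b \<in> A" "d = inv g \<otimes> b \<otimes> g"
      by blast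
    then have "c \<otimes> d = inv g \<otimes> (a \<otimes> b) \<otimes> g"
      using g by (simp add: group_word)
    then show "c \<otimes> d \<in> (\<lambda>a. inv g \<otimes> a \<otimes> g) ` A"
      using a b by blast
  qed
qed

lemma conjugate_image_mult:
  assumes "A \<subseteq> carrier G" "g \<in> carrier G" "h \<in> carrier G"
  shows "(\<lambda>a. inv (g \<otimes> h) \<otimes> a \<otimes> (g \<otimes> h)) ` A
    = (\<lambda>a. inv h \<otimes> a \<otimes> h) ` ((\<lambda>a. inv g \<otimes> a \<otimes> g) ` A)"
  unfolding image_image using assms by (intro image_cong) (auto simp: group_word subset_iff)

lemma conjugate_image_inv:
  assumes "A \<subseteq> carrier G" "g \<in> carrier G"
  shows "(\<lambda>a. inv (inv g) \<otimes> a \<otimes> inv g) ` ((\<lambda>a. inv g \<otimes> a \<otimes> g) ` A) = A"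
proof -
  have "(\<lambda>a. inv (inv g) \<otimes> (inv g \<otimes> a \<otimes> g) \<otimes> inv g) ` A = (\<lambda>a. a) ` A"
    using assms by (intro image_cong) (auto simp: group_word subset_iff)
  then show ?thesis
    by (simp add: image_image)
qed

definition conj_by where "conj_by x v = x \<otimes> v \<otimes> inv x"

lemma conj_by_closed [simp]: "x \<in> carrier G \<Longrightarrow> v \<in> carrier G \<Longrightarrow> conj_by x v \<in> carrier G"
  by (simp add: conj_by_def)

lemma conj_by_mult:
  "x \<in> carrier G \<Longrightarrow> u \<in> carrier G \<Longrightarrow> v \<in> carrier G \<Longrightarrow>
    conj_by x (u \<otimes> v) = conj_by x u \<otimes> conj_by x v"
  by (simp add: conj_by_def group_word)

lemma conj_by_inv: "x \<in> carrier G \<Longrightarrow> v \<in> carrier G \<Longrightarrow> conj_by x (inv v) = inv (conj_by x v)"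
  by (simp add: conj_by_def group_word)

lemma conjugate_eq_image:
  "conjugate G A g = (\<lambda>a. inv g \<otimes> a \<otimes> g) ` A"
  by (auto simp: conjugate_def l_coset_def r_coset_def)

text \<open>
The normalizer is the stabilizer for the action \<open>A \<mapsto> g A g\<^sup>-\<^sup>1\<close>; the convention \<open>A\<^sup>g = g\<^sup>-\<^sup>1 A g\<close> has the
same stabilizers.
\<close>
lemma normalizer_iff:
  assumes A: "A \<subseteq> carrier G"
  shows "g \<in> normalizer G A \<longleftrightarrow> g \<in> carrier G \<and> (\<lambda>a. inv g \<otimes> a \<otimes> g) ` A = A"
proof (cases "g \<in> carrier G")
  case True
  have "g \<in> normalizer G A \<longleftrightarrow> (\<lambda>a. inv (inv g) \<otimes> a \<otimes> inv g) ` A = A"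
    using True A by (auto simp: normalizer_def stabilizer_def l_coset_def r_coset_def)
  also have "\<dots> \<longleftrightarrow> (\<lambda>a. inv g \<otimes> a \<otimes> g) ` A = A"
    using conjugate_image_inv[OF A True] conjugate_image_inv[OF A inv_closed[OF True]] True by auto
  finally show ?thesis
    using True by simp
qed (simp add: normalizer_def stabilizer_def)

end

section \<open>Transfer into an abelian malnormal subgroup\<close>

context group
begin

text \<open>
The orbits of \<open>H\<close> on \<open>S\<close> all have the size of \<open>H\<close>.  Applied to the nontrivial elements of a
normal subgroup, this yields that its order is congruent to one modulo the order of \<open>H\<close>.
\<close>
lemma card_dvd_free_conjugation:
  assumes H: "subgroup H G" and S: "S \<subseteq> carrier G" and fin: "finite S"
    and closed: "\<And>h v. h \<in> H \<Longrightarrow> v \<in> S \<Longrightarrow> inv h \<otimes> v \<otimes> h \<in> S"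
    and free: "\<And>h v. h \<in> H \<Longrightarrow> v \<in> S \<Longrightarrow> h \<otimes> v = v \<otimes> h \<Longrightarrow> h = \<one>"
  shows "card H dvd card S"
proof -
  define orb where "orb v = (\<lambda>h. inv h \<otimes> v \<otimes> h) ` H" for v
  have hG: "h \<in> carrier G" if "h \<in> H" for h
    using subgroup.mem_carrier[OF H that] .
  have vG: "v \<in> carrier G" if "v \<in> S" for v
    using S that by blast
  have self: "v \<in> orb v" if "v \<in> S" for v
    unfolding orb_def using subgroup.one_closed[OF H] that vG by (force intro: image_eqI[of _ _ \<one>])
  have un: "S = \<Union>(orb ` S)"
    using self closed unfolding orb_def by blast
  have card_orb: "card (orb v) = card H" if v: "v \<in> S" for v
  proof -
    have "inj_on (\<lambda>h. inv h \<otimes> v \<otimes> h) H"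
    proof (rule inj_onI)
      fix a b assume ab: "a \<in> H" "b \<in> H" and eq: "inv a \<otimes> v \<otimes> a = inv b \<otimes> v \<otimes> b"
      have G: "a \<in> carrier G" "b \<in> carrier G" "v \<in> carrier G"
        using ab v hG vG by auto
      have "(a \<otimes> inv b) \<otimes> v = a \<otimes> (inv b \<otimes> v \<otimes> b) \<otimes> inv b"
        using G by (simp add: group_word)
      also have "\<dots> = v \<otimes> (a \<otimes> inv b)"
        using G by (simp add: eq[symmetric]) (simp add: group_word)
      finally have "a \<otimes> inv b = \<one>"
        using free[of "a \<otimes> inv b" v] ab v H by (simp add: subgroup.m_closed subgroup.m_inv_closed)
      then show "a = b"
        using G by (metis inv_closed inv_equality inv_inv)
    qed
    then show ?thesis
      unfolding orb_def by (rule card_image)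
  qed
  have eq: "orb u \<subseteq> orb v" if u: "u \<in> orb v" "v \<in> S" for u v
  proof
    fix w assume "w \<in> orb u"
    then obtain a where a: "a \<in> H" "w = inv a \<otimes> u \<otimes> a"
      unfolding orb_def by blast
    moreover obtain b where b: "b \<in> H" "u = inv b \<otimes> v \<otimes> b"
      using u unfolding orb_def by blast
    ultimately have "w = inv (b \<otimes> a) \<otimes> v \<otimes> (b \<otimes> a)"
      using hG vG \<open>v \<in> S\<close> by (simp add: group_word)
    then show "w \<in> orb v"
      unfolding orb_def using a(1) b(1) subgroup.m_closed[OF H] by blast
  qed
  have sym: "v \<in> orb u" if u: "u \<in> orb v" "v \<in> S" for u v
  proof -
    obtain a where a: "a \<in> H" "u = inv a \<otimes> v \<otimes> a"
      using u unfolding orb_def by blast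
    then have "v = inv (inv a) \<otimes> u \<otimes> inv a"
      using hG vG \<open>v \<in> S\<close> by (simp add: group_word)
    then show ?thesis
      unfolding orb_def using a subgroup.m_inv_closed[OF H] by blast
  qed
  have subX: "orb v \<subseteq> S" if "v \<in> S" for v
    using closed that unfolding orb_def by blast
  have disj: "c1 \<inter> c2 = {}" if c: "c1 \<in> orb ` S" "c2 \<in> orb ` S" "c1 \<noteq> c2" for c1 c2
  proof (rule ccontr)
    assume "c1 \<inter> c2 \<noteq> {}"
    then obtain u v w where *: "v \<in> S" "w \<in> S" "c1 = orb v" "c2 = orb w" "u \<in> orb v" "u \<in> orb w"
      using c by blast
    then have "u \<in> S"
      using subX by blast
    then have "orb v = orb u" "orb w = orb u"
      using * eq sym by (meson subset_antisym)+
    then show False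
      using * c by simp
  qed
  have "card H dvd card (\<Union>(orb ` S))"
  proof (rule dvd_partition)
    show "finite (\<Union>(orb ` S))"
      using fin by (simp flip: un)
    show "\<forall>c\<in>orb ` S. card H dvd card c"
      using card_orb by simp
    show "\<forall>c1\<in>orb ` S. \<forall>c2\<in>orb ` S. c1 \<noteq> c2 \<longrightarrow> c1 \<inter> c2 = {}"
      using disj by blast
  qed
  with un show ?thesis
    by (metis (no_types))
qed

text \<open>
Outside \<open>H\<close>, the expression of an element of \<open>H r H\<close> as \<open>a r b\<close> is unique when \<open>H\<close> is malnormal.
Choosing one \<open>r\<close> in every double coset and sending \<open>a r b\<close> to \<open>b\<close> gives a retraction that is equivariant for
right multiplication by \<open>H\<close>, and invariant under left multiplication away from \<open>H\<close> itself.  Its fibre over the identity is a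
transversal adapted to the left action of \<open>H\<close>, for which the transfer is easy to evaluate on \<open>H\<close>.
\<close>
lemma malnormal_retraction:
  assumes H: "subgroup H G"
    and mal: "\<forall>g\<in>carrier G. \<forall>h\<in>H - {\<one>}. inv g \<otimes> h \<otimes> g \<in> H \<longrightarrow> g \<in> H"
  shows "\<exists>rt. (\<forall>g\<in>carrier G. rt g \<in> H)
    \<and> (\<forall>g\<in>carrier G. \<forall>h\<in>H. rt (g \<otimes> h) = rt g \<otimes> h)
    \<and> (\<forall>g\<in>carrier G - H. \<forall>h\<in>H. rt (h \<otimes> g) = rt g)
    \<and> (\<forall>h\<in>H. rt h = h)"
proof -
  interpret H: subgroup H G by (rule H)
  define DC where "DC g = {a \<otimes> g \<otimes> b |a b. a \<in> H \<and> b \<in> H}" for g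
  define rep where "rep g = (SOME r. r \<in> DC g)" for g
  define rt where "rt g = (if g \<in> H then g else THE b. b \<in> H \<and> (\<exists>a\<in>H. g = a \<otimes> rep g \<otimes> b))" for g
  have DC_shift: "DC (c \<otimes> g \<otimes> d) = DC g" if g: "g \<in> carrier G" "c \<in> H" "d \<in> H" for c d g
  proof -
    have "a \<otimes> (c \<otimes> g \<otimes> d) \<otimes> b \<in> DC g" if "a \<in> H" "b \<in> H" for a b
    proof -
      have "a \<otimes> (c \<otimes> g \<otimes> d) \<otimes> b = (a \<otimes> c) \<otimes> g \<otimes> (d \<otimes> b)"
        using that g by (simp add: group_word)
      then show ?thesis
        unfolding DC_def using that g H.m_closed by blast
    qed
    moreover have "a \<otimes> g \<otimes> b \<in> DC (c \<otimes> g \<otimes> d)" if "a \<in> H" "b \<in> H" for a b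
    proof -
      have "a \<otimes> g \<otimes> b = (a \<otimes> inv c) \<otimes> (c \<otimes> g \<otimes> d) \<otimes> (inv d \<otimes> b)"
        using that g by (simp add: group_word)
      then show ?thesis
        unfolding DC_def using that g H.m_closed H.m_inv_closed by blast
    qed
    ultimately show ?thesis
      unfolding DC_def[of g] DC_def[of "c \<otimes> g \<otimes> d"] by blast
  qed
  have rep_in: "rep g \<in> DC g" if "g \<in> carrier G" for g
  proof -
    have "\<one> \<otimes> g \<otimes> \<one> \<in> DC g"
      unfolding DC_def using H.one_closed by blast
    then show ?thesis
      unfolding rep_def by (rule someI)
  qed
  have rep: "rep g \<in> carrier G - H" "\<exists>a\<in>H. \<exists>b\<in>H. g = a \<otimes> rep g \<otimes> b"
    if g: "g \<in> carrier G" "g \<notin> H" for g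
  proof -
    obtain a b where ab: "a \<in> H" "b \<in> H" "rep g = a \<otimes> g \<otimes> b"
      using rep_in[OF g(1)] unfolding DC_def by blast
    then have eq: "g = inv a \<otimes> rep g \<otimes> inv b"
      using g by (simp add: group_word)
    then show "\<exists>a\<in>H. \<exists>b\<in>H. g = a \<otimes> rep g \<otimes> b"
      using ab by blast
    show "rep g \<in> carrier G - H"
      using eq ab g by (metis DiffI H.m_closed H.m_inv_closed H.mem_carrier m_closed)
  qed
  have unique: "b = b'" if r: "r \<in> carrier G - H" and H: "a \<in> H" "b \<in> H" "a' \<in> H" "b' \<in> H"
    and eq: "a \<otimes> r \<otimes> b = a' \<otimes> r \<otimes> b'" for r a b a' b'
  proof -
    have "inv r \<otimes> (inv a' \<otimes> a) \<otimes> r = inv r \<otimes> inv a' \<otimes> (a \<otimes> r \<otimes> b) \<otimes> inv b"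
      using r H by (simp add: group_word)
    also have "\<dots> = b' \<otimes> inv b"
      unfolding eq using r H by (simp add: group_word)
    finally have "inv r \<otimes> (inv a' \<otimes> a) \<otimes> r \<in> H"
      using H by simp
    then have "inv a' \<otimes> a = \<one>"
      using mal r H by (metis DiffD1 DiffD2 DiffI H.m_closed H.m_inv_closed singletonD)
    then have "a = a'"
      using H by (metis H.mem_carrier inv_closed inv_equality inv_inv)
    then show ?thesis
      using eq r H by (simp add: m_assoc)
  qed
  have rt_eq: "rt g = b" if "g \<in> carrier G" "g \<notin> H" "a \<in> H" "b \<in> H" "g = a \<otimes> rep g \<otimes> b" for g a b
    using that(2) unfolding rt_def
    by simp (rule the_equality, use that unique rep(1) in blast, use that unique rep(1) in metis)
  have shift: "rt (c \<otimes> g \<otimes> d) = rt g \<otimes> d" if g: "g \<in> carrier G" "g \<notin> H" "c \<in> H" "d \<in> H" for g c d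
  proof -
    obtain a b where ab: "a \<in> H" "b \<in> H" "g = a \<otimes> rep g \<otimes> b"
      using rep(2)[OF g(1,2)] by blast
    have G: "rep g \<in> carrier G" "c \<in> carrier G" "d \<in> carrier G" "a \<in> carrier G" "b \<in> carrier G"
      using rep(1) g ab by auto
    have "c \<otimes> g \<otimes> d = c \<otimes> (a \<otimes> rep g \<otimes> b) \<otimes> d"
      using ab(3) by simp
    then have 1: "c \<otimes> g \<otimes> d = (c \<otimes> a) \<otimes> rep (c \<otimes> g \<otimes> d) \<otimes> (b \<otimes> d)"
      using G DC_shift[OF g(1,3,4)] unfolding rep_def by (simp add: m_assoc)
    have "g = inv c \<otimes> (c \<otimes> g \<otimes> d) \<otimes> inv d"
      using g by (simp add: group_word)
    then have "c \<otimes> g \<otimes> d \<notin> H"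
      using g H.m_closed H.m_inv_closed by metis
    then have "rt (c \<otimes> g \<otimes> d) = b \<otimes> d"
      using rt_eq[OF _ _ _ _ 1] ab g by simp
    then show ?thesis
      using rt_eq[OF g(1,2) ab] by simp
  qed
  show ?thesis
  proof (intro exI[of _ rt] conjI ballI)
    fix g assume g: "g \<in> carrier G"
    show "rt g \<in> H"
    proof (cases "g \<in> H")
      case False
      then show ?thesis
        using rep(2)[OF g] rt_eq[OF g] by blast
    qed (simp add: rt_def)
  next
    fix g h assume g: "g \<in> carrier G" "h \<in> H"
    show "rt (g \<otimes> h) = rt g \<otimes> h"
    proof (cases "g \<in> H")
      case False
      then show ?thesis
        using shift[OF g(1) False H.one_closed g(2)] g by simp
    qed (use g in \<open>simp add: rt_def\<close>)
  next
    fix g h assume gH: "g \<in> carrier G - H" and "h \<in> H"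
    then have g: "g \<in> carrier G" "h \<in> H" "g \<notin> H"
      by auto
    show "rt (h \<otimes> g) = rt g"
      using shift[OF g(1,3,2) H.one_closed] g shift[OF g(1,3) H.one_closed H.one_closed] by simp
  next
    fix h assume "h \<in> H"
    then show "rt h = h"
      by (simp add: rt_def)
  qed
qed

text \<open>
The complement is the kernel of the transfer \<open>V\<close> into \<open>H\<close>.  Relative to the transversal \<open>R\<close> on which
the retraction is trivial, \<open>V k\<close> is the product of the \<open>H\<close>-components of \<open>k r\<close>.  On \<open>H\<close>
the map \<open>V\<close> is the identity: left multiplication by \<open>h\<close> permutes the elements of \<open>R\<close> other than \<open>\<one>\<close>,
so that only \<open>r = \<one>\<close> contributes.  Hence \<open>V\<close> splits.
\<close>
lemma abelian_malnormal_complement: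
  assumes fin: "finite (carrier G)" and H: "subgroup H G"
    and comm: "\<And>a b. a \<in> H \<Longrightarrow> b \<in> H \<Longrightarrow> a \<otimes> b = b \<otimes> a"
    and mal: "\<forall>g\<in>carrier G. \<forall>h\<in>H - {\<one>}. inv g \<otimes> h \<otimes> g \<in> H \<longrightarrow> g \<in> H"
  shows "\<exists>N. N \<lhd> G \<and> N \<inter> H = {\<one>} \<and> (\<forall>g\<in>carrier G. \<exists>h\<in>H. h \<otimes> g \<in> N)"
proof -
  interpret H: subgroup H G by (rule H)
  let ?H = "G\<lparr>carrier := H\<rparr>"
  interpret HH: comm_group ?H
    by (rule group.group_comm_groupI[OF subgroup_imp_group[OF H]]) (simp add: comm)
  obtain rt where rt': "\<forall>g\<in>carrier G. rt g \<in> H"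
    and right': "\<forall>g\<in>carrier G. \<forall>h\<in>H. rt (g \<otimes> h) = rt g \<otimes> h"
    and left': "\<forall>g\<in>carrier G - H. \<forall>h\<in>H. rt (h \<otimes> g) = rt g"
    and retr': "\<forall>h\<in>H. rt h = h"
    using malnormal_retraction[OF H mal] by (elim exE conjE) (rule that)
  note rt = rt'[rule_format] and right = right'[rule_format]
    and left = left'[rule_format, OF DiffI] and retr = retr'[rule_format]
  define R where "R = {r \<in> carrier G. rt r = \<one>}"
  define V where "V k = finprod ?H (\<lambda>r. rt (k \<otimes> r)) R" for k
  have RG: "r \<in> carrier G" if "r \<in> R" for r
    using that by (simp add: R_def)
  have finR: "finite R"
    using fin by (simp add: R_def)
  have VH: "V k \<in> H" if "k \<in> carrier G" for k
    using HH.finprod_closed[of "\<lambda>r. rt (k \<otimes> r)" R] that rt RG by (auto simp: V_def Pi_def)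
  \<comment> \<open>the permutation of the transversal induced by left multiplication with \<open>l\<close>\<close>
  define s where "s l r = l \<otimes> r \<otimes> inv (rt (l \<otimes> r))" for l r
  have sR: "s l r \<in> R" if "l \<in> carrier G" "r \<in> R" for l r
  proof -
    have lr: "l \<otimes> r \<in> carrier G"
      using that RG by simp
    then have m: "rt (l \<otimes> r) \<in> H"
      by (rule rt)
    then have "rt (s l r) = \<one>"
      unfolding s_def using right[OF lr] by (metis H.m_inv_closed H.mem_carrier r_inv)
    then show ?thesis
      unfolding R_def using lr m by (simp add: s_def)
  qed
  have inj: "inj_on (s l) R" if l: "l \<in> carrier G" for l
  proof (rule inj_onI)
    fix r r' assume r: "r \<in> R" "r' \<in> R" and eq: "s l r = s l r'"
    define a where "a = rt (l \<otimes> r)"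
    define a' where "a' = rt (l \<otimes> r')"
    have a: "a \<in> H" "a' \<in> H"
      using rt RG r l by (auto simp: a_def a'_def)
    have "r' = inv l \<otimes> (s l r') \<otimes> a'"
      unfolding s_def a'_def[symmetric] using a RG r l by (simp add: group_word)
    also have "\<dots> = r \<otimes> (inv a \<otimes> a')"
      unfolding eq[symmetric] unfolding s_def a_def[symmetric] using a RG r l by (simp add: group_word)
    finally have r': "r' = r \<otimes> (inv a \<otimes> a')" .
    then have "rt r' = rt r \<otimes> (inv a \<otimes> a')"
      using right[of r "inv a \<otimes> a'"] a RG r by simp
    then have "inv a \<otimes> a' = \<one>"
      using r a by (simp add: R_def)
    then show "r = r'"
      using r' RG r by simp
  qed
  have V_mult: "V (k \<otimes> l) = V k \<otimes> V l" if k: "k \<in> carrier G" and l: "l \<in> carrier G" for k l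
  proof -
    have bij: "s l ` R = R"
      by (rule endo_inj_surj[OF finR _ inj[OF l]]) (use sR l in blast)
    have "rt (k \<otimes> l \<otimes> r) = rt (k \<otimes> s l r) \<otimes> rt (l \<otimes> r)" if r: "r \<in> R" for r
    proof -
      have "k \<otimes> l \<otimes> r = k \<otimes> s l r \<otimes> rt (l \<otimes> r)"
        using k l RG r rt[of "l \<otimes> r"] by (simp add: s_def group_word)
      moreover have "s l r \<in> carrier G"
        using sR RG r l by blast
      ultimately show ?thesis
        using right[of "k \<otimes> s l r" "rt (l \<otimes> r)"] k l RG r rt by simp
    qed
    then have "V (k \<otimes> l) = finprod ?H (\<lambda>r. rt (k \<otimes> s l r) \<otimes>\<^bsub>?H\<^esub> rt (l \<otimes> r)) R"
      unfolding V_def using rt k l RG sR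
      by (intro HH.finprod_cong') (auto simp: Pi_def)
    also have "\<dots> = finprod ?H (\<lambda>r. rt (k \<otimes> s l r)) R \<otimes>\<^bsub>?H\<^esub> V l"
      unfolding V_def using rt k l RG sR by (intro HH.finprod_multf) (auto simp: Pi_def)
    also have "finprod ?H (\<lambda>r. rt (k \<otimes> s l r)) R = finprod ?H (\<lambda>r. rt (k \<otimes> r)) (s l ` R)"
      using rt k l RG sR inj by (intro HH.finprod_reindex[symmetric]) (auto simp: Pi_def)
    finally show ?thesis
      by (simp add: V_def bij)
  qed
  have V_H: "V h = h" if h: "h \<in> H" for h
  proof -
    have one: "\<one> \<in> R"
      using retr by (simp add: R_def)
    have "r \<notin> H" if "r \<in> R - {\<one>}" for r
      using that retr by (auto simp: R_def)
    then have "rt (h \<otimes> r) = \<one>" if "r \<in> R - {\<one>}" for r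
      using left[of r h] that h by (auto simp: R_def)
    then have rest: "finprod ?H (\<lambda>r. rt (h \<otimes> r)) (R - {\<one>}) = \<one>"
      using HH.finprod_one_eqI[of "R - {\<one>}" "\<lambda>r. rt (h \<otimes> r)"] by simp
    have "V h = finprod ?H (\<lambda>r. rt (h \<otimes> r)) (insert \<one> (R - {\<one>}))"
      unfolding V_def using one by (simp add: insert_absorb)
    also have "\<dots> = rt (h \<otimes> \<one>) \<otimes>\<^bsub>?H\<^esub> finprod ?H (\<lambda>r. rt (h \<otimes> r)) (R - {\<one>})"
      using finR rt h RG by (intro HH.finprod_insert) (auto simp: Pi_def)
    finally show ?thesis
      using rest retr h by simp
  qed
  define N where "N = kernel G ?H V"
  have "group_hom G ?H V"
    unfolding group_hom_def group_hom_axioms_def hom_def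
    using VH V_mult HH.is_group is_group by auto
  then have "N \<lhd> G"
    unfolding N_def by (rule group_hom.normal_kernel)
  moreover have "N \<inter> H = {\<one>}"
    using V_H unfolding N_def kernel_def by auto
  moreover have "\<exists>h\<in>H. h \<otimes> g \<in> N" if g: "g \<in> carrier G" for g
  proof
    show "inv (V g) \<in> H"
      using VH g by simp
    then show "inv (V g) \<otimes> g \<in> N"
      using VH g V_mult[of "inv (V g)" g] V_H[of "inv (V g)"] by (simp add: N_def kernel_def)
  qed
  ultimately show ?thesis
    by blast
qed

text \<open>
The map \<open>w \<mapsto> h\<^sup>-\<^sup>1 w\<^sup>-\<^sup>1 h w\<close> from \<open>N\<close> to itself is injective because its fibres are cosets of the
centralizer of \<open>h\<close>; as \<open>N\<close> is finite it is onto, which says that \<open>h N\<close> consists of conjugates of \<open>h\<close>.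
\<close>
lemma fixed_point_free_conjugates:
  assumes N: "subgroup N G" and fin: "finite N" and h: "h \<in> carrier G"
    and norm: "\<And>v. v \<in> N \<Longrightarrow> inv h \<otimes> v \<otimes> h \<in> N"
    and free: "\<And>v. v \<in> N \<Longrightarrow> h \<otimes> v = v \<otimes> h \<Longrightarrow> v = \<one>"
    and v: "v \<in> N"
  obtains w where "w \<in> N" "h \<otimes> v = inv w \<otimes> h \<otimes> w"
proof -
  interpret N: subgroup N G by (rule N)
  define c where "c w = (inv h \<otimes> inv w \<otimes> h) \<otimes> w" for w
  have "inj_on c N"
  proof (rule inj_onI)
    fix a b assume ab: "a \<in> N" "b \<in> N" and eq: "c a = c b"
    have "h \<otimes> (b \<otimes> inv a) = b \<otimes> h \<otimes> (c b) \<otimes> inv a"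
      using ab h by (simp add: c_def group_word)
    also have "\<dots> = (b \<otimes> inv a) \<otimes> h"
      unfolding eq[symmetric] using ab h by (simp add: c_def group_word)
    finally have "b \<otimes> inv a = \<one>"
      using free[of "b \<otimes> inv a"] ab by simp
    then show "a = b"
      using ab by (metis N.mem_carrier inv_closed inv_equality inv_inv)
  qed
  moreover have "c ` N \<subseteq> N"
    using norm by (auto simp: c_def)
  ultimately have "c ` N = N"
    using endo_inj_surj fin by blast
  then obtain w where w: "w \<in> N" "v = c w"
    using v by blast
  then have "h \<otimes> v = inv w \<otimes> h \<otimes> w"
    using h by (simp add: c_def group_word)
  then show thesis
    using w that by blast
qed

end

section \<open>Conjugacy classes whose pairs generate Frobenius groups\<close>

text \<open>
The situation of the theorem, stated for the whole conjugacy class so that any two of its members may play the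
part of \<open>H\<close> and a conjugate.
\<close>
locale frobenius_pairs = group G for G (structure) +
  fixes p :: nat and D :: "'a set set"
  assumes fin: "finite (carrier G)"
    and p_prime: "Factorial_Ring.prime p"
    and D_subgroup: "A \<in> D \<Longrightarrow> subgroup A G"
    and D_card: "A \<in> D \<Longrightarrow> card A = p"
    and D_conj: "A \<in> D \<Longrightarrow> g \<in> carrier G \<Longrightarrow> (\<lambda>a. inv g \<otimes> a \<otimes> g) ` A \<in> D"
    and D_pair: "A \<in> D \<Longrightarrow> B \<in> D \<Longrightarrow> k \<in> generate G (A \<union> B) \<Longrightarrow>
      (\<lambda>a. inv k \<otimes> a \<otimes> k) ` A = A \<Longrightarrow> k \<in> A"
begin

definition T where "T = \<Union>D - {\<one>}"

lemma D_mem: "A \<in> D \<Longrightarrow> a \<in> A \<Longrightarrow> a \<in> carrier G"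
  by (rule subgroup.mem_carrier[OF D_subgroup])

lemma D_closed:
  assumes "A \<in> D" "a \<in> A"
  shows "inv a \<in> A" and "b \<in> A \<Longrightarrow> a \<otimes> b \<in> A"
  using subgroup.m_inv_closed[OF D_subgroup[OF assms(1)]]
    subgroup.m_closed[OF D_subgroup[OF assms(1)]] assms(2) by auto

lemma D_one: "A \<in> D \<Longrightarrow> \<one> \<in> A"
  by (rule subgroup.one_closed[OF D_subgroup])

lemma D_T: "A \<in> D \<Longrightarrow> a \<in> A \<Longrightarrow> a \<noteq> \<one> \<Longrightarrow> a \<in> T"
  by (auto simp: T_def)

lemma TE:
  assumes "t \<in> T"
  obtains A where "A \<in> D" "t \<in> A" "t \<noteq> \<one>"
  using assms by (auto simp: T_def)

lemma T_mem: "t \<in> T \<Longrightarrow> t \<in> carrier G"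
  by (erule TE) (rule D_mem)

lemma one_notin_T: "\<one> \<notin> T"
  by (simp add: T_def)

lemma T_inv: "t \<in> T \<Longrightarrow> inv t \<in> T"
  by (erule TE) (simp add: D_T D_closed(1) D_mem)

lemma T_conj:
  assumes "t \<in> T" "g \<in> carrier G"
  shows "inv g \<otimes> t \<otimes> g \<in> T"
proof -
  obtain A where A: "A \<in> D" "t \<in> A" "t \<noteq> \<one>"
    using assms(1) by (rule TE)
  have "inv g \<otimes> t \<otimes> g \<noteq> \<one>"
  proof
    assume "inv g \<otimes> t \<otimes> g = \<one>"
    then have "g \<otimes> (inv g \<otimes> t \<otimes> g) \<otimes> inv g = \<one>"
      using assms by simp
    then show False
      using A assms T_mem by (simp add: group_word)
  qed
  then show ?thesis
    using D_T[OF D_conj[OF A(1) assms(2)]] A(2) by blast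
qed

lemma T_conj_iff:
  assumes "t \<in> carrier G" "g \<in> carrier G"
  shows "inv g \<otimes> t \<otimes> g \<in> T \<longleftrightarrow> t \<in> T" and "g \<otimes> t \<otimes> inv g \<in> T \<longleftrightarrow> t \<in> T"
proof -
  have *: "t \<in> T" if "inv g \<otimes> t \<otimes> g \<in> T" "t \<in> carrier G" "g \<in> carrier G" for t g
    using T_conj[OF that(1), of "inv g"] that(2,3) by (simp add: group_word)
  show "inv g \<otimes> t \<otimes> g \<in> T \<longleftrightarrow> t \<in> T"
    using *[OF _ assms] T_conj[OF _ assms(2)] by blast
  show "g \<otimes> t \<otimes> inv g \<in> T \<longleftrightarrow> t \<in> T"
    using *[of "inv g" t] T_conj[of t "inv g"] assms inv_inv[OF assms(2)] inv_closed[OF assms(2)] by metis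
qed

lemma T_commute:
  assumes "a \<in> carrier G" "b \<in> carrier G"
  shows "a \<otimes> b \<in> T \<longleftrightarrow> b \<otimes> a \<in> T"
  using T_conj_iff(1)[of "a \<otimes> b" a] assms by (simp add: group_word)

lemma D_eqI:
  assumes "A \<in> D" "B \<in> D" "a \<in> A" "a \<in> B" "a \<noteq> \<one>"
  shows "A = B"
proof
  show "A \<subseteq> B"
    using prime_order_subset[of A B a] assms D_subgroup D_card p_prime by simp
  show "B \<subseteq> A"
    using prime_order_subset[of B A a] assms D_subgroup D_card p_prime by simp
qed

lemma D_commute: "A \<in> D \<Longrightarrow> a \<in> A \<Longrightarrow> b \<in> A \<Longrightarrow> a \<otimes> b = b \<otimes> a"
  using prime_order_commute[OF D_subgroup[of A]] D_card[of A] p_prime by simp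

lemma D_finite: "A \<in> D \<Longrightarrow> finite A"
  using subgroup.subset[OF D_subgroup] fin finite_subset by metis

lemma D_nontrivial:
  assumes "A \<in> D"
  obtains a where "a \<in> A" "a \<noteq> \<one>"
proof -
  have "A \<noteq> {\<one>}"
    using D_card[OF assms] p_prime by auto
  then show thesis
    using that D_one[OF assms] by blast
qed

lemma D_pair_subgroup:
  assumes "A \<in> D" "B \<in> D"
  shows "subgroup (generate G (A \<union> B)) G"
  using subgroup.subset[OF D_subgroup[OF assms(1)]] subgroup.subset[OF D_subgroup[OF assms(2)]]
  by (intro generate_is_subgroup Un_least)

lemma malnormal_in_pair:
  assumes A: "A \<in> D" and B: "B \<in> D" and g: "g \<in> generate G (A \<union> B)"
    and a: "a \<in> A" "a \<noteq> \<one>" "inv g \<otimes> a \<otimes> g \<in> A"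
  shows "g \<in> A"
proof (rule D_pair[OF A B g])
  have gG: "g \<in> carrier G"
    using subgroup.mem_carrier[OF D_pair_subgroup[OF A B] g] .
  have "inv g \<otimes> a \<otimes> g \<noteq> \<one>"
    using one_notin_T T_conj[OF D_T[OF A a(1,2)] gG] by metis
  then show "(\<lambda>a. inv g \<otimes> a \<otimes> g) ` A = A"
    using D_eqI[OF D_conj[OF A gG] A _ a(3)] a(1) by blast
qed

text \<open>
\<open>A\<close> is malnormal in the group \<open>K\<close> generated by the pair, hence has a normal complement \<open>N\<close>.  As \<open>A\<close>
acts freely on the nontrivial elements of \<open>N\<close>, the order of \<open>N\<close> is prime to \<open>p\<close>, so \<open>N\<close> contains no member
of \<open>D\<close>, whether or not that member is conjugate to \<open>A\<close> in \<open>K\<close>.  Conversely the coset \<open>a N\<close> consists of conjugates of \<open>a\<close>.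
\<close>
lemma frobenius_kernel:
  assumes A: "A \<in> D" and B: "B \<in> D"
  obtains N where "subgroup N G" "N \<subseteq> generate G (A \<union> B)" "N \<inter> T = {}"
    and "\<And>a v. a \<in> A \<Longrightarrow> v \<in> N \<Longrightarrow> inv a \<otimes> v \<otimes> a \<in> N"
    and "\<And>k. k \<in> generate G (A \<union> B) \<Longrightarrow> \<exists>a\<in>A. a \<otimes> k \<in> N"
    and "\<And>a v. a \<in> A \<Longrightarrow> a \<noteq> \<one> \<Longrightarrow> v \<in> N \<Longrightarrow> \<exists>w\<in>N. a \<otimes> v = inv w \<otimes> a \<otimes> w"
proof -
  define K where "K = generate G (A \<union> B)"
  let ?K = "G\<lparr>carrier := K\<rparr>"
  have K: "subgroup K G"
    unfolding K_def by (rule D_pair_subgroup[OF A B])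
  interpret K: group ?K
    by (rule subgroup_imp_group[OF K])
  have KG: "k \<in> carrier G" if "k \<in> K" for k
    using subgroup.mem_carrier[OF K that] .
  have AK: "A \<subseteq> K"
    unfolding K_def by (auto intro: generate.incl)
  have "subgroup A ?K"
    by (rule subgroup_incl[OF D_subgroup[OF A] K AK])
  moreover have "\<forall>g\<in>carrier ?K. \<forall>h\<in>A - {\<one>\<^bsub>?K\<^esub>}. inv\<^bsub>?K\<^esub> g \<otimes>\<^bsub>?K\<^esub> h \<otimes>\<^bsub>?K\<^esub> g \<in> A \<longrightarrow> g \<in> A"
    using malnormal_in_pair[OF A B] m_inv_consistent[OF K] by (auto simp: K_def)
  moreover have "finite (carrier ?K)"
    using KG fin finite_subset[of K] by auto
  ultimately have "\<exists>N. N \<lhd> ?K \<and> N \<inter> A = {\<one>} \<and> (\<forall>k\<in>K. \<exists>a\<in>A. a \<otimes> k \<in> N)"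
    using K.abelian_malnormal_complement[of A] D_commute[OF A] by simp
  then obtain N where N: "N \<lhd> ?K" "N \<inter> A = {\<one>}" and NA: "\<forall>k\<in>K. \<exists>a\<in>A. a \<otimes> k \<in> N"
    by blast
  have NK: "N \<subseteq> K"
    using normal_imp_subgroup[OF N(1)] subgroup.subset by fastforce
  have subN: "subgroup N G"
    by (rule incl_subgroup[OF K normal_imp_subgroup[OF N(1)]])
  have norm: "inv k \<otimes> v \<otimes> k \<in> N" if "k \<in> K" "v \<in> N" for k v
    using normal.inv_op_closed1[OF N(1)] that m_inv_consistent[OF K] by simp
  have NG: "v \<in> carrier G" if "v \<in> N" for v
    using NK KG that by blast
  have finN: "finite N"
    using NG fin finite_subset[of N] by blast
  have free: "v = \<one>" if "a \<in> A" "a \<noteq> \<one>" "v \<in> N" "a \<otimes> v = v \<otimes> a" for a v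
  proof -
    have "inv v \<otimes> a \<otimes> v = a"
      using that NG D_mem[OF A] by (simp add: m_assoc) (simp add: group_word)
    then have "v \<in> A"
      using malnormal_in_pair[OF A B, of v a] that NK by (auto simp: K_def)
    then show ?thesis
      using N(2) that by blast
  qed
  have "card A dvd card (N - {\<one>})"
  proof (rule card_dvd_free_conjugation[OF D_subgroup[OF A]])
    fix a v assume av: "a \<in> A" "v \<in> N - {\<one>}"
    have "inv a \<otimes> v \<otimes> a \<noteq> \<one>"
    proof
      assume "inv a \<otimes> v \<otimes> a = \<one>"
      then have "a \<otimes> (inv a \<otimes> v \<otimes> a) \<otimes> inv a = \<one>"
        using av D_mem[OF A] by simp
      then show False
        using av D_mem[OF A] NG by (simp add: group_word)
    qed
    then show "inv a \<otimes> v \<otimes> a \<in> N - {\<one>}"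
      using norm av AK by blast
  qed (use NG finN free in auto)
  then have "p dvd card N - 1"
    using D_card[OF A] subgroup.one_closed[OF subN] by simp
  then have ndvd: "\<not> p dvd card N"
    using p_prime finN subgroup.one_closed[OF subN]
    by (metis Suc_pred card_gt_0_iff dvd_add_right_iff empty_iff nat_dvd_1_iff_1 not_prime_1 plus_1_eq_Suc One_nat_def add.commute)
  have "N \<inter> T = {}"
  proof (rule ccontr)
    assume "N \<inter> T \<noteq> {}"
    then obtain t C where t: "t \<in> N" "C \<in> D" "t \<in> C" "t \<noteq> \<one>"
      by (metis TE disjoint_iff)
    have "C \<subseteq> N"
      using prime_order_subset[of C N t] t subN D_subgroup D_card p_prime by simp
    then have "card C dvd card N"
      by (rule subgroup_card_dvd[OF D_subgroup[OF t(2)] subN])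
    then show False
      using ndvd D_card t by simp
  qed
  show thesis
  proof (rule that[of N])
    fix a v assume "a \<in> A" "v \<in> N"
    then show "inv a \<otimes> v \<otimes> a \<in> N"
      using norm AK by blast
  next
    fix a v assume a: "a \<in> A" "a \<noteq> \<one>" "v \<in> N"
    show "\<exists>w\<in>N. a \<otimes> v = inv w \<otimes> a \<otimes> w"
      by (rule fixed_point_free_conjugates[OF subN finN D_mem[OF A a(1)] _ _ a(3)])
        (use norm free a AK in blast)+
  qed (use subN NK NA \<open>N \<inter> T = {}\<close> in \<open>auto simp: K_def\<close>)
qed

text \<open>
With \<open>B \<in> D\<close> containing \<open>f\<close> and \<open>N\<close> the kernel for the pair \<open>A, B\<close>: the coset \<open>f A\<close> lies in \<open>A N\<close>,
where \<open>T\<close> is exactly the complement of \<open>N\<close>, and \<open>A\<close> is a transversal of \<open>N\<close>.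
\<close>
lemma coset_meets_T:
  assumes f: "f \<in> T" and A: "A \<in> D"
  shows "\<exists>!t. t \<in> A \<and> f \<otimes> t \<notin> T"
proof -
  obtain B where B: "B \<in> D" "f \<in> B"
    using f by (rule TE)
  obtain N where N: "subgroup N G" "N \<inter> T = {}"
    and norm: "\<And>a v. a \<in> A \<Longrightarrow> v \<in> N \<Longrightarrow> inv a \<otimes> v \<otimes> a \<in> N"
    and K: "\<And>k. k \<in> generate G (A \<union> B) \<Longrightarrow> \<exists>a\<in>A. a \<otimes> k \<in> N"
    and conj: "\<And>a v. a \<in> A \<Longrightarrow> a \<noteq> \<one> \<Longrightarrow> v \<in> N \<Longrightarrow> \<exists>w\<in>N. a \<otimes> v = inv w \<otimes> a \<otimes> w"
    using frobenius_kernel[OF A B(1)] by metis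
  have NG: "v \<in> carrier G" if "v \<in> N" for v
    using subgroup.mem_carrier[OF N(1) that] .
  have AG: "a \<in> carrier G" if "a \<in> A" for a
    using D_mem[OF A that] .
  have fG: "f \<in> carrier G"
    using T_mem[OF f] .
  have AN_T: "a \<otimes> v \<in> T" if "a \<in> A" "a \<noteq> \<one>" "v \<in> N" for a v
    using conj[OF that] T_conj[OF D_T[OF A that(1,2)]] NG by metis
  obtain a where a: "a \<in> A" "a \<otimes> f \<in> N"
    using K[of f] B(2) generate.incl[of f "A \<union> B" G] by blast
  have fa: "f \<otimes> a \<in> N"
    using norm[OF a] a fG AG by (simp add: group_word)
  show ?thesis
  proof (rule ex1I[of _ a])
    show "a \<in> A \<and> f \<otimes> a \<notin> T"
      using a fa N(2) by blast
  next
    fix t assume t: "t \<in> A \<and> f \<otimes> t \<notin> T"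
    define b where "b = inv a \<otimes> t"
    have b: "b \<in> A"
      unfolding b_def using a t D_closed[OF A] by blast
    have "f \<otimes> t = b \<otimes> (inv b \<otimes> (f \<otimes> a) \<otimes> b)"
      using a t AG fG b by (simp add: b_def group_word)
    then have "b = \<one>"
      using AN_T[OF b _ norm[OF b fa]] t by auto
    then show "t = a"
      using a t AG unfolding b_def by (metis inv_closed inv_equality inv_inv)
  qed
qed

text \<open>
An element of \<open>B\<close> lies in some coset \<open>c N\<close> with \<open>c \<in> A\<close> nontrivial, and such a coset consists of
\<open>K\<close>-conjugates of \<open>c\<close>.  So the fusion of the class already happens inside the two-generator subgroups.
\<close>
lemma pair_conjugate:
  assumes A: "A \<in> D" and B: "B \<in> D"
  obtains w where "w \<in> generate G (A \<union> B)" "B = (\<lambda>a. inv w \<otimes> a \<otimes> w) ` A"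
proof -
  obtain N where N: "subgroup N G" "N \<subseteq> generate G (A \<union> B)" "N \<inter> T = {}"
    and K: "\<And>k. k \<in> generate G (A \<union> B) \<Longrightarrow> \<exists>a\<in>A. a \<otimes> k \<in> N"
    and conj: "\<And>a v. a \<in> A \<Longrightarrow> a \<noteq> \<one> \<Longrightarrow> v \<in> N \<Longrightarrow> \<exists>w\<in>N. a \<otimes> v = inv w \<otimes> a \<otimes> w"
    using frobenius_kernel[OF A B] by metis
  obtain b where b: "b \<in> B" "b \<noteq> \<one>"
    using D_nontrivial[OF B] .
  obtain a where a: "a \<in> A" "a \<otimes> b \<in> N"
    using K[of b] b generate.incl[of b "A \<union> B" G] by blast
  have bT: "b \<in> T"
    using D_T B b by blast
  have bG: "b \<in> carrier G" "a \<in> carrier G"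
    using D_mem A B a b by auto
  have "a \<noteq> \<one>"
    using a bT bG N(3) by auto
  then have "inv a \<noteq> \<one>"
    using bG by simp
  then obtain w where w: "w \<in> N" "inv a \<otimes> (a \<otimes> b) = inv w \<otimes> inv a \<otimes> w"
    using conj[OF D_closed(1)[OF A a(1)] _ a(2)] by blast
  then have "b = inv w \<otimes> inv a \<otimes> w"
    using bG by (simp add: group_word)
  moreover have "w \<in> carrier G"
    using subgroup.mem_carrier[OF N(1) w(1)] .
  ultimately have "B = (\<lambda>a. inv w \<otimes> a \<otimes> w) ` A"
    using D_eqI[OF B D_conj[OF A] b(1) _ b(2)] D_closed(1)[OF A a(1)] by blast
  then show thesis
    using that N w by blast
qed

section \<open>The multipliers of the class\<close>

definition Z where "Z = {g \<in> carrier G. \<forall>t\<in>T. g \<otimes> t \<in> T}"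

lemma ZD: "z \<in> Z \<Longrightarrow> z \<in> carrier G" "z \<in> Z \<Longrightarrow> t \<in> T \<Longrightarrow> z \<otimes> t \<in> T"
  by (auto simp: Z_def)

lemma Z_right: "z \<in> Z \<Longrightarrow> t \<in> T \<Longrightarrow> t \<otimes> z \<in> T"
  using ZD T_commute T_mem by metis

lemma finite_T: "finite T"
  using T_mem fin finite_subset[of T "carrier G"] by blast

lemma Z_notin_T: "z \<in> Z \<Longrightarrow> z \<notin> T"
  using ZD[of z] T_inv[of z] one_notin_T by (metis r_inv)

lemma Z_subgroup: "subgroup Z G"
proof (rule subgroupI)
  show "Z \<subseteq> carrier G"
    by (auto simp: Z_def)
  show "Z \<noteq> {}"
    using T_mem by (force simp: Z_def intro: exI[of _ \<one>])
next
  fix z assume z: "z \<in> Z"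
  have zG: "z \<in> carrier G"
    using z by (rule ZD)
  have "(\<lambda>t. z \<otimes> t) ` T = T"
  proof (rule endo_inj_surj[OF finite_T])
    show "(\<lambda>t. z \<otimes> t) ` T \<subseteq> T"
      using ZD(2)[OF z] by blast
    show "inj_on (\<lambda>t. z \<otimes> t) T"
      using zG T_mem by (simp add: inj_on_def)
  qed
  then have "inv z \<otimes> t \<in> T" if t: "t \<in> T" for t
  proof -
    obtain s where s: "s \<in> T" "t = z \<otimes> s"
      using t \<open>(\<lambda>t. z \<otimes> t) ` T = T\<close> by blast
    then show ?thesis
      using zG T_mem[of s] by (simp add: group_word)
  qed
  then show "inv z \<in> Z"
    using zG by (simp add: Z_def)
next
  fix y z assume "y \<in> Z" "z \<in> Z"
  then show "y \<otimes> z \<in> Z"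
    using T_mem by (simp add: Z_def m_assoc)
qed

lemma Z_conj:
  assumes z: "z \<in> Z" and g: "g \<in> carrier G"
  shows "inv g \<otimes> z \<otimes> g \<in> Z" and "g \<otimes> z \<otimes> inv g \<in> Z"
proof -
  have *: "inv g \<otimes> z \<otimes> g \<in> Z" if g: "g \<in> carrier G" for g
  proof -
    have "inv g \<otimes> z \<otimes> g \<otimes> t \<in> T" if t: "t \<in> T" for t
    proof -
      have "z \<otimes> (g \<otimes> t \<otimes> inv g) \<in> T"
        using ZD(2)[OF z] T_conj_iff(2)[OF T_mem[OF t] g] t by blast
      then have "inv g \<otimes> (z \<otimes> (g \<otimes> t \<otimes> inv g)) \<otimes> g \<in> T"
        using g by (rule T_conj)
      then show ?thesis
        using g T_mem[OF t] ZD(1)[OF z] by (simp add: group_word)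
    qed
    then show ?thesis
      using g ZD(1)[OF z] by (simp add: Z_def)
  qed
  show "inv g \<otimes> z \<otimes> g \<in> Z"
    by (rule *[OF g])
  show "g \<otimes> z \<otimes> inv g \<in> Z"
    using *[of "inv g"] g by simp
qed

lemma Z_normal: "Z \<lhd> G"
  unfolding normal_inv_iff using Z_subgroup Z_conj(2) by blast

lemma D_Int_Z: "A \<in> D \<Longrightarrow> a \<in> A \<Longrightarrow> a \<in> Z \<Longrightarrow> a = \<one>"
  using D_T Z_notin_T by blast

text \<open>
If \<open>z\<close> commutes with \<open>a\<close>, then \<open>z a \<in> T\<close> lies in some \<open>C \<in> D\<close> and centralizes \<open>a\<close>; malnormality of \<open>A\<close> in
the group generated by \<open>A\<close> and \<open>C\<close> puts \<open>z a\<close>, and hence \<open>z\<close>, into \<open>A\<close>.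
\<close>
lemma Z_centralizer:
  assumes A: "A \<in> D" and a: "a \<in> A" "a \<noteq> \<one>" and z: "z \<in> Z" "a \<otimes> z = z \<otimes> a"
  shows "z = \<one>"
proof -
  have G: "a \<in> carrier G" "z \<in> carrier G"
    using D_mem[OF A a(1)] ZD(1)[OF z(1)] by auto
  have "z \<otimes> a \<in> T"
    by (rule ZD(2)[OF z(1) D_T[OF A a]])
  then obtain C where C: "C \<in> D" "z \<otimes> a \<in> C"
    by (rule TE)
  have "inv (z \<otimes> a) \<otimes> a \<otimes> (z \<otimes> a) = inv (z \<otimes> a) \<otimes> (a \<otimes> z) \<otimes> a"
    using G by (simp add: m_assoc)
  also have "\<dots> = a"
    unfolding z(2) using G by (simp add: group_word)
  finally have "inv (z \<otimes> a) \<otimes> a \<otimes> (z \<otimes> a) \<in> A"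
    using a by simp
  then have "z \<otimes> a \<in> A"
    using malnormal_in_pair[OF A C(1) _ a] C(2) by (simp add: generate.incl)
  then have "z \<otimes> a \<otimes> inv a \<in> A"
    using D_closed[OF A] a(1) by blast
  then show ?thesis
    using D_Int_Z[OF A] z(1) G by (simp add: m_assoc)
qed

lemma p_not_dvd_card_Z:
  assumes "D \<noteq> {}"
  shows "\<not> p dvd card Z"
proof -
  obtain A where A: "A \<in> D"
    using assms by blast
  have finZ: "finite Z"
    using fin finite_subset[of Z "carrier G"] ZD(1) by blast
  have "card A dvd card (Z - {\<one>})"
  proof (rule card_dvd_free_conjugation[OF D_subgroup[OF A]])
    fix a z assume az: "a \<in> A" "z \<in> Z - {\<one>}"
    have G: "a \<in> carrier G" "z \<in> carrier G"
      using az D_mem[OF A] ZD(1) by auto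
    have "inv a \<otimes> z \<otimes> a \<noteq> \<one>"
    proof
      assume "inv a \<otimes> z \<otimes> a = \<one>"
      then have "a \<otimes> (inv a \<otimes> z \<otimes> a) \<otimes> inv a = \<one>"
        using G by simp
      then show False
        using az G by (simp add: group_word)
    qed
    then show "inv a \<otimes> z \<otimes> a \<in> Z - {\<one>}"
      using Z_conj(1) az G by blast
  qed (use ZD(1) finZ Z_centralizer[OF A] in auto)
  moreover have "card Z = Suc (card (Z - {\<one>}))"
    using card.remove[OF finZ subgroup.one_closed[OF Z_subgroup]] .
  ultimately show ?thesis
    using D_card[OF A] p_prime
    by (metis dvd_add_right_iff nat_dvd_1_iff_1 not_prime_1 plus_1_eq_Suc add.commute)
qed

context
  assumes products: "\<And>x y. x \<in> T \<Longrightarrow> y \<in> T \<Longrightarrow> x \<otimes> y \<in> T \<or> x \<otimes> y \<in> Z"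
begin

text \<open>
The coset \<open>b A\<close> contains an element \<open>b a\<close> outside \<open>T\<close>, and the assumption on products places it in \<open>Z\<close>.
\<close>
lemma D_subset_Z_mult:
  assumes A: "A \<in> D" and B: "B \<in> D" and b: "b \<in> B"
  obtains z a where "z \<in> Z" "a \<in> A" "b = z \<otimes> a"
proof (cases "b = \<one>")
  case True
  then show ?thesis
    using that[OF subgroup.one_closed[OF Z_subgroup] D_one[OF A]] by simp
next
  case False
  then have bT: "b \<in> T"
    by (rule D_T[OF B b])
  then obtain a where a: "a \<in> A" "b \<otimes> a \<notin> T"
    using coset_meets_T[OF _ A] by blast
  have G: "a \<in> carrier G" "b \<in> carrier G"
    using D_mem A B a(1) b by auto
  have "a \<noteq> \<one>"
    using a bT G by auto
  then have "b \<otimes> a \<in> Z"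
    using products[OF bT D_T[OF A a(1)]] a(2) by blast
  moreover have "b = (b \<otimes> a) \<otimes> inv a"
    using G by (simp add: m_assoc)
  ultimately show ?thesis
    using that D_closed(1)[OF A a(1)] by blast
qed

text \<open>
If \<open>z a\<close> normalizes \<open>A\<close>, then so does \<open>z\<close>, and for \<open>c \<in> A\<close> the commutator of \<open>c\<close> and \<open>z\<close> lies in \<open>A \<inter> Z\<close>, which is trivial.
So \<open>z\<close> centralizes \<open>A\<close>.
\<close>
lemma normalizer_in_Z_mult:
  assumes A: "A \<in> D" and z: "z \<in> Z" and a: "a \<in> A"
    and norm: "(\<lambda>h. inv (z \<otimes> a) \<otimes> h \<otimes> (z \<otimes> a)) ` A = A"
  shows "z = \<one>"
proof -
  obtain c where c: "c \<in> A" "c \<noteq> \<one>"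
    using D_nontrivial[OF A] .
  have G: "a \<in> carrier G" "c \<in> carrier G" "z \<in> carrier G"
    using D_mem[OF A] ZD(1) a c z by auto
  define d where "d = inv (z \<otimes> a) \<otimes> c \<otimes> (z \<otimes> a)"
  have d: "d \<in> A"
    unfolding d_def using norm c by blast
  have "inv c \<otimes> (a \<otimes> d \<otimes> inv a) = (inv c \<otimes> inv z \<otimes> c) \<otimes> z"
    unfolding d_def using G by (simp add: group_word)
  moreover have "inv c \<otimes> (a \<otimes> d \<otimes> inv a) \<in> A"
    using D_closed[OF A] a c d by simp
  moreover have "(inv c \<otimes> inv z \<otimes> c) \<otimes> z \<in> Z"
    using subgroup.m_closed[OF Z_subgroup Z_conj(1)[OF subgroup.m_inv_closed[OF Z_subgroup z]] z] G by blast
  ultimately have "(inv c \<otimes> inv z \<otimes> c) \<otimes> z = \<one>"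
    using D_Int_Z[OF A] by metis
  then have "z \<otimes> c \<otimes> ((inv c \<otimes> inv z \<otimes> c) \<otimes> z) = z \<otimes> c"
    using G by simp
  then have "c \<otimes> z = z \<otimes> c"
    using G by (simp add: group_word)
  then show ?thesis
    by (rule Z_centralizer[OF A c z])
qed

text \<open>
A conjugate \<open>t\<close> of a nontrivial element of \<open>A\<close> lies in a coset \<open>a Z\<close>, and \<open>Z\<close> acts without fixed points, so \<open>a Z\<close>
consists of \<open>Z\<close>-conjugates of \<open>a\<close>.
\<close>
lemma conjugate_by_Z:
  assumes A: "A \<in> D" and g: "g \<in> carrier G"
  obtains w where "w \<in> Z" "(\<lambda>a. inv g \<otimes> a \<otimes> g) ` A = (\<lambda>a. inv w \<otimes> a \<otimes> w) ` A"
proof -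
  obtain c where c: "c \<in> A" "c \<noteq> \<one>"
    using D_nontrivial[OF A] .
  define t where "t = inv g \<otimes> c \<otimes> g"
  have t: "t \<in> T" "t \<in> (\<lambda>a. inv g \<otimes> a \<otimes> g) ` A"
    unfolding t_def using T_conj[OF D_T[OF A c] g] c by auto
  obtain z a where za: "z \<in> Z" "a \<in> A" "t = z \<otimes> a"
    using D_subset_Z_mult[OF A D_conj[OF A g] t(2)] .
  have G: "z \<in> carrier G" "a \<in> carrier G"
    using za ZD(1) D_mem[OF A] by auto
  have a1: "a \<noteq> \<one>"
    using za t(1) Z_notin_T G by auto
  have "finite Z"
    using fin finite_subset[of Z "carrier G"] ZD(1) by blast
  then obtain w where w: "w \<in> Z" "a \<otimes> (inv a \<otimes> z \<otimes> a) = inv w \<otimes> a \<otimes> w"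
    using fixed_point_free_conjugates[OF Z_subgroup _ G(2) Z_conj(1)[OF _ G(2)] Z_centralizer[OF A za(2) a1]
        Z_conj(1)[OF za(1) G(2)]] by blast
  then have "t = inv w \<otimes> a \<otimes> w"
    using za(3) G by (simp add: group_word)
  then have "t \<in> (\<lambda>a. inv w \<otimes> a \<otimes> w) ` A"
    using za(2) by blast
  then have "(\<lambda>a. inv g \<otimes> a \<otimes> g) ` A = (\<lambda>a. inv w \<otimes> a \<otimes> w) ` A"
    using D_eqI[OF D_conj[OF A g] D_conj[OF A ZD(1)[OF w(1)]] t(2)] t(1) one_notin_T by metis
  then show thesis
    using that w by blast
qed

end

section \<open>Primes above three\<close>

lemma finite_D: "finite D"
  using fin subgroup.subset[OF D_subgroup] finite_subset[of D "Pow (carrier G)"] by blast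

lemma card_T: "card T = card D * (p - 1)"
proof -
  have T_eq: "T = (\<Union>A\<in>D. A - {\<one>})"
    by (auto simp: T_def)
  have "card T = (\<Sum>A\<in>D. card (A - {\<one>}))"
    unfolding T_eq using finite_D D_finite D_eqI by (intro card_UN_disjoint) blast+
  also have "\<dots> = (\<Sum>A\<in>D. p - 1)"
    using D_card D_one D_finite by (intro sum.cong) auto
  finally show ?thesis
    by simp
qed

text \<open>
The size of this set measures how far \<open>g\<close> is from stabilizing \<open>T\<close>; it is subadditive in \<open>g\<close>.
\<close>
definition misses where "misses g = {t \<in> T. g \<otimes> t \<notin> T}"

lemma finite_misses: "finite (misses g)"
  using finite_T by (simp add: misses_def)

text \<open>
One element is missed in every member of \<open>D\<close>, by the condition on cosets.
\<close>
lemma card_misses_T: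
  assumes g: "g \<in> T"
  shows "card (misses g) = card D"
proof -
  define f where "f A = (THE t. t \<in> A \<and> g \<otimes> t \<notin> T)" for A
  have f: "f A \<in> A" "g \<otimes> f A \<notin> T" if "A \<in> D" for A
    unfolding f_def using theI'[OF coset_meets_T[OF g that]] by auto
  have f1: "f A \<noteq> \<one>" if "A \<in> D" for A
    using f(2)[OF that] g T_mem[OF g] by auto
  have inj: "inj_on f D"
    using D_eqI f(1) f1 by (metis inj_onI)
  have "f ` D = misses g"
  proof
    show "f ` D \<subseteq> misses g"
      using f f1 D_T by (auto simp: misses_def)
    show "misses g \<subseteq> f ` D"
    proof
      fix t assume "t \<in> misses g"
      then have t: "t \<in> T" "g \<otimes> t \<notin> T"
        by (auto simp: misses_def)
      obtain A where A: "A \<in> D" "t \<in> A"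
        using t(1) by (rule TE)
      have "f A = t"
        unfolding f_def using coset_meets_T[OF g A(1)] A t by (intro the1_equality) auto
      then show "t \<in> f ` D"
        using A by blast
    qed
  qed
  then show ?thesis
    using card_image[OF inj] by simp
qed

lemma card_misses_mult:
  assumes g: "g \<in> carrier G" and h: "h \<in> carrier G"
  shows "card (misses (g \<otimes> h)) \<le> card (misses g) + card (misses h)"
proof -
  have "misses (g \<otimes> h) \<subseteq> (\<lambda>s. inv h \<otimes> s) ` misses g \<union> misses h"
  proof
    fix t assume "t \<in> misses (g \<otimes> h)"
    then have t: "t \<in> T" "g \<otimes> h \<otimes> t \<notin> T"
      by (auto simp: misses_def)
    show "t \<in> (\<lambda>s. inv h \<otimes> s) ` misses g \<union> misses h"
    proof (cases "h \<otimes> t \<in> T")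
      case True
      then have "h \<otimes> t \<in> misses g"
        using t g h T_mem by (simp add: misses_def m_assoc)
      moreover have "t = inv h \<otimes> (h \<otimes> t)"
        using h T_mem[OF t(1)] by (simp add: group_word)
      ultimately show ?thesis
        by blast
    next
      case False
      then show ?thesis
        using t by (simp add: misses_def)
    qed
  qed
  then have "card (misses (g \<otimes> h)) \<le> card ((\<lambda>s. inv h \<otimes> s) ` misses g \<union> misses h)"
    using finite_misses by (intro card_mono) auto
  also have "\<dots> \<le> card ((\<lambda>s. inv h \<otimes> s) ` misses g) + card (misses h)"
    by (rule card_Un_le)
  also have "\<dots> \<le> card (misses g) + card (misses h)"
    using card_image_le[OF finite_misses] by simp
  finally show ?thesis .
qed

text \<open>
The product moves at most \<open>3 n\<close> elements of \<open>T\<close> out of \<open>T\<close>, where \<open>n\<close> is the number of members of \<open>D\<close>,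
and \<open>3 n\<close> is less than \<open>n (p - 1)\<close>.  An element that stays in \<open>T\<close> exhibits the product as a quotient of two elements of \<open>T\<close>.
\<close>
lemma triple_product:
  assumes p: "5 \<le> p" and xyz: "x \<in> T" "y \<in> T" "z \<in> T"
  obtains a b where "a \<in> T" "b \<in> T" "x \<otimes> y \<otimes> z = a \<otimes> b"
proof -
  have G: "x \<in> carrier G" "y \<in> carrier G" "z \<in> carrier G"
    using xyz T_mem by auto
  have "D \<noteq> {}"
    using xyz(1) by (auto simp: T_def)
  then have n: "0 < card D"
    using finite_D by (simp add: card_gt_0_iff)
  have "card (misses (x \<otimes> y \<otimes> z)) \<le> 3 * card D"
    using card_misses_mult[of "x \<otimes> y" z] card_misses_mult[of x y] G card_misses_T xyz by simp
  also have "\<dots> < card D * (p - 1)"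
    using n p by simp
  finally have "misses (x \<otimes> y \<otimes> z) \<noteq> T"
    using card_T by auto
  then obtain t where t: "t \<in> T" "x \<otimes> y \<otimes> z \<otimes> t \<in> T"
    by (auto simp: misses_def)
  moreover have "x \<otimes> y \<otimes> z = (x \<otimes> y \<otimes> z \<otimes> t) \<otimes> inv t"
    using G T_mem[OF t(1)] by (simp add: group_word)
  ultimately show thesis
    using that T_inv by metis
qed

definition TT where "TT = {x \<otimes> y |x y. x \<in> T \<and> y \<in> T}"

lemma TT_subgroup:
  assumes p: "5 \<le> p" and ne: "T \<noteq> {}"
  shows "subgroup TT G" and "T \<subseteq> TT"
proof -
  obtain t where t: "t \<in> T"
    using ne by blast
  show "T \<subseteq> TT"
  proof
    fix x assume x: "x \<in> T"
    obtain a b where ab: "a \<in> T" "b \<in> T" "x \<otimes> x \<otimes> inv x = a \<otimes> b"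
      using triple_product[OF p x x T_inv[OF x]] .
    \<comment> \<open>a single element is a product of two because it is a product of three\<close>
    have "x = x \<otimes> x \<otimes> inv x"
      using T_mem[OF x] by (simp add: m_assoc)
    then show "x \<in> TT"
      using ab unfolding TT_def by auto
  qed
  have absorb: "g \<otimes> z \<in> TT" if "g \<in> TT" "z \<in> T" for g z
  proof -
    obtain x y where xy: "x \<in> T" "y \<in> T" "g = x \<otimes> y"
      using \<open>g \<in> TT\<close> unfolding TT_def by blast
    obtain a b where "a \<in> T" "b \<in> T" "x \<otimes> y \<otimes> z = a \<otimes> b"
      using triple_product[OF p xy(1,2) \<open>z \<in> T\<close>] .
    then show ?thesis
      unfolding TT_def xy(3) by blast
  qed
  have TT_G: "TT \<subseteq> carrier G"
    using T_mem by (auto simp: TT_def)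
  show "subgroup TT G"
  proof (rule subgroupI[OF TT_G])
    show "TT \<noteq> {}"
      using t by (auto simp: TT_def)
  next
    fix g assume "g \<in> TT"
    then obtain x y where xy: "x \<in> T" "y \<in> T" "g = x \<otimes> y"
      unfolding TT_def by blast
    then have "inv g = inv y \<otimes> inv x"
      using T_mem by (simp add: inv_mult_group)
    then show "inv g \<in> TT"
      unfolding TT_def using T_inv xy by blast
  next
    fix g h assume g: "g \<in> TT" and "h \<in> TT"
    then obtain x y where xy: "x \<in> T" "y \<in> T" "h = x \<otimes> y"
      unfolding TT_def by blast
    have "g \<otimes> h = g \<otimes> x \<otimes> y"
      using xy g TT_G T_mem by (simp add: m_assoc subset_iff)
    then show "g \<otimes> h \<in> TT"
      using absorb[OF absorb[OF g xy(1)] xy(2)] by simp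
  qed
qed

text \<open>
\<open>M\<close> acts transitively on \<open>D\<close> by conjugation, because any two members are conjugate in the subgroup that they
generate; \<open>s\<close> is the order of a point stabilizer, which contains \<open>A\<close>.
\<close>
lemma card_D_dvd:
  assumes M: "subgroup M G" and DM: "\<And>A. A \<in> D \<Longrightarrow> A \<subseteq> M" and A: "A \<in> D"
  obtains s where "card M = card D * s" "p dvd s"
proof -
  \<comment> \<open>\<open>M\<close> is the union of these fibres, each of which is a coset of the stabilizer \<open>F A\<close>\<close>
  define F where "F B = {g \<in> M. (\<lambda>a. inv g \<otimes> a \<otimes> g) ` A = B}" for B
  have MG: "g \<in> carrier G" if "g \<in> M" for g
    using subgroup.mem_carrier[OF M that] .
  note conj_mult = conjugate_image_mult[OF subgroup.subset[OF D_subgroup[OF A]]]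
    and conj_inv = conjugate_image_inv[OF subgroup.subset[OF D_subgroup[OF A]]]
  have finM: "finite M"
    using MG fin finite_subset[of M "carrier G"] by blast
  have card_F: "card (F B) = card (F A)" if B: "B \<in> D" for B
  proof -
    obtain w where w: "w \<in> generate G (A \<union> B)" "B = (\<lambda>a. inv w \<otimes> a \<otimes> w) ` A"
      using pair_conjugate[OF A B] .
    then have wM: "w \<in> M"
      using generate_subgroup_incl[of "A \<union> B" M] M DM A B by blast
    have wG: "w \<in> carrier G"
      using MG wM .
    have "F B = (\<lambda>g. g \<otimes> w) ` F A"
    proof
      show "(\<lambda>g. g \<otimes> w) ` F A \<subseteq> F B"
      proof (rule image_subsetI)
        fix g assume "g \<in> F A"
        then have g: "g \<in> M" "(\<lambda>a. inv g \<otimes> a \<otimes> g) ` A = A"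
          by (auto simp: F_def)
        have "(\<lambda>a. inv (g \<otimes> w) \<otimes> a \<otimes> (g \<otimes> w)) ` A = B"
          unfolding conj_mult[OF MG[OF g(1)] wG] g(2) w(2) ..
        then show "g \<otimes> w \<in> F B"
          using subgroup.m_closed[OF M g(1) wM] by (simp add: F_def)
      qed
      show "F B \<subseteq> (\<lambda>g. g \<otimes> w) ` F A"
      proof
        fix g assume "g \<in> F B"
        then have g: "g \<in> M" "(\<lambda>a. inv g \<otimes> a \<otimes> g) ` A = B"
          by (auto simp: F_def)
        have "(\<lambda>a. inv (g \<otimes> inv w) \<otimes> a \<otimes> (g \<otimes> inv w)) ` A = A"
          unfolding conj_mult[OF MG[OF g(1)] inv_closed[OF wG]] g(2)
          unfolding w(2) using conj_inv[OF wG] .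
        then have "g \<otimes> inv w \<in> F A"
          using g wM subgroup.m_closed[OF M] subgroup.m_inv_closed[OF M] by (simp add: F_def)
        moreover have "g = g \<otimes> inv w \<otimes> w"
          using MG[OF g(1)] wG by (simp add: m_assoc)
        ultimately show "g \<in> (\<lambda>g. g \<otimes> w) ` F A"
          by blast
      qed
    qed
    moreover have "inj_on (\<lambda>g. g \<otimes> w) (F A)"
      using wG MG by (auto simp: inj_on_def F_def)
    ultimately show ?thesis
      using card_image by metis
  qed
  have "M = (\<Union>B\<in>D. F B)"
    using D_conj[OF A] MG by (auto simp: F_def)
  moreover have "card (\<Union>B\<in>D. F B) = (\<Sum>B\<in>D. card (F B))"
    using finite_D finM by (intro card_UN_disjoint) (auto simp: F_def)
  ultimately have "card M = card D * card (F A)"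
    using card_F by simp
  moreover have "p dvd card (F A)"
  proof -
    have "subgroup (F A) G"
    proof (rule subgroupI)
      show "F A \<subseteq> carrier G"
        using MG by (auto simp: F_def)
      have "(\<lambda>a. inv \<one> \<otimes> a \<otimes> \<one>) ` A = (\<lambda>a. a) ` A"
        using D_mem[OF A] by (intro image_cong) auto
      then have "\<one> \<in> F A"
        using subgroup.one_closed[OF M] by (simp add: F_def)
      then show "F A \<noteq> {}"
        by blast
    next
      fix g assume "g \<in> F A"
      then have g: "g \<in> M" "(\<lambda>a. inv g \<otimes> a \<otimes> g) ` A = A"
        by (auto simp: F_def)
      then show "inv g \<in> F A"
        using conj_inv[OF MG[OF g(1)]] subgroup.m_inv_closed[OF M] by (simp add: F_def)
    next
      fix g h assume "g \<in> F A" "h \<in> F A"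
      then show "g \<otimes> h \<in> F A"
        using conj_mult[OF MG MG] subgroup.m_closed[OF M] by (simp add: F_def)
    qed
    moreover have "A \<subseteq> F A"
    proof
      fix b assume b: "b \<in> A"
      have "inv b \<otimes> a \<otimes> b = a" if "a \<in> A" for a
        using D_commute[OF A that b] D_mem[OF A] that b by (simp add: group_word)
      then have "(\<lambda>a. inv b \<otimes> a \<otimes> b) ` A = (\<lambda>a. a) ` A"
        by (intro image_cong) auto
      then show "b \<in> F A"
        using b DM[OF A] by (auto simp: F_def)
    qed
    ultimately show ?thesis
      using subgroup_card_dvd[OF D_subgroup[OF A]] D_card[OF A] by metis
  qed
  ultimately show thesis
    by (rule that)
qed

text \<open>
Counts the pairs \<open>(g, t)\<close> with \<open>g \<in> M\<close> and \<open>t, g t \<in> T\<close>: they correspond to all pairs of elements of \<open>T\<close>.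
\<close>
lemma sum_card_misses:
  assumes M: "subgroup M G" and TM: "T \<subseteq> M"
  shows "(\<Sum>g\<in>M. card (misses g)) + card T * card T = card M * card T"
proof -
  have MG: "g \<in> carrier G" if "g \<in> M" for g
    using subgroup.mem_carrier[OF M that] .
  have finM: "finite M"
    using MG fin finite_subset[of M "carrier G"] by blast
  have "bij_betw (\<lambda>(g, t). (g \<otimes> t, t)) (SIGMA g:M. T - misses g) (T \<times> T)"
  proof (rule bij_betw_byWitness[where f' = "\<lambda>(s, t). (s \<otimes> inv t, t)"])
    show "\<forall>gt\<in>(SIGMA g:M. T - misses g). (\<lambda>(s, t). (s \<otimes> inv t, t)) ((\<lambda>(g, t). (g \<otimes> t, t)) gt) = gt"
      using MG T_mem by (auto simp: m_assoc)
    show "\<forall>st\<in>T \<times> T. (\<lambda>(g, t). (g \<otimes> t, t)) ((\<lambda>(s, t). (s \<otimes> inv t, t)) st) = st"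
      using T_mem by (auto simp: m_assoc)
    show "(\<lambda>(g, t). (g \<otimes> t, t)) ` (SIGMA g:M. T - misses g) \<subseteq> T \<times> T"
      by (auto simp: misses_def)
    have "s \<otimes> inv t \<in> M" if "s \<in> T" "t \<in> T" for s t
      using that TM subgroup.m_closed[OF M] subgroup.m_inv_closed[OF M] by blast
    then show "(\<lambda>(s, t). (s \<otimes> inv t, t)) ` (T \<times> T) \<subseteq> (SIGMA g:M. T - misses g)"
      using T_mem by (auto simp: misses_def m_assoc)
  qed
  then have "card (SIGMA g:M. T - misses g) = card (T \<times> T)"
    by (rule bij_betw_same_card)
  moreover have "card (SIGMA g:M. T - misses g) = (\<Sum>g\<in>M. card (T - misses g))"
    using finM finite_T by (intro card_SigmaI) auto
  moreover have "card (misses g) + card (T - misses g) = card T" for g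
    using card_Diff_subset[OF finite_misses, of g T] card_mono[OF finite_T, of "misses g"]
    by (simp add: misses_def)
  then have "(\<Sum>g\<in>M. card (misses g)) + (\<Sum>g\<in>M. card (T - misses g)) = card M * card T"
    by (simp flip: sum.distrib)
  ultimately show ?thesis
    by (simp add: card_cartesian_product)
qed

text \<open>
Let \<open>n\<close> be the number of members of \<open>D\<close> and \<open>n r\<close> the number of elements of \<open>T T\<close> outside \<open>T\<close>.  Elements of \<open>T\<close> miss
\<open>n\<close> elements each, so double counting expresses the total \<open>\<Sigma>\<close> of the numbers missed outside \<open>T\<close> as
\<open>n\<^sup>2 (p - 1) (r - 1)\<close>, whereas \<open>\<Sigma> \<le> 2 n\<^sup>2 r\<close> since each product misses at most \<open>2 n\<close>.  As \<open>r\<close> is congruent to one modulo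
\<open>p\<close>, only \<open>r = 1\<close> is possible, and then \<open>\<Sigma> = 0\<close>.
\<close>
lemma products_large_prime:
  assumes p: "5 \<le> p" and xy: "x \<in> T" "y \<in> T"
  shows "x \<otimes> y \<in> T \<or> x \<otimes> y \<in> Z"
proof -
  obtain A where A: "A \<in> D"
    using xy(1) by (rule TE)
  have n: "0 < card D"
    using A finite_D by (auto simp: card_gt_0_iff)
  have "T \<noteq> {}"
    using xy by blast
  note TT = TT_subgroup[OF p this]
  have DM: "B \<subseteq> TT" if "B \<in> D" for B
    using TT(2) subgroup.one_closed[OF TT(1)] that by (auto simp: T_def)
  obtain s where s: "card TT = card D * s" "p dvd s"
    using card_D_dvd[OF TT(1) DM A] .
  have finTT: "finite TT"
    using subgroup.subset[OF TT(1)] fin finite_subset by blast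
  define r where "r = s - (p - 1)"
  define \<Sigma> where "\<Sigma> = (\<Sum>g\<in>TT - T. card (misses g))"
  have "card T \<le> card TT"
    using TT(2) finTT by (rule card_mono[rotated])
  then have "s = r + (p - 1)"
    using s n card_T by (simp add: r_def)
  then have card_TT: "card TT = card D * (r + (p - 1))"
    using s by simp
  have card_R: "card (TT - T) = card D * r"
    using card_Diff_subset[OF finite_T TT(2)] card_TT card_T by (simp add: algebra_simps)
  have "(\<Sum>g\<in>TT. card (misses g)) = \<Sigma> + (\<Sum>g\<in>T. card (misses g))"
    unfolding \<Sigma>_def using sum.subset_diff[OF TT(2) finTT] by simp
  also have "(\<Sum>g\<in>T. card (misses g)) = card T * card D"
    using card_misses_T by simp
  finally have "\<Sigma> + card T * card D + card T * card T = card TT * card T"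
    using sum_card_misses[OF TT] by simp
  then have count: "\<Sigma> + card D * (card D * (p - 1)) = card D * (card D * ((p - 1) * r))"
    unfolding card_TT card_T by (simp add: algebra_simps)
  have "card (misses g) \<le> 2 * card D" if g: "g \<in> TT" for g
  proof -
    obtain a b where ab: "a \<in> T" "b \<in> T" "g = a \<otimes> b"
      using g unfolding TT_def by blast
    then show ?thesis
      using card_misses_mult[of a b] card_misses_T T_mem by simp
  qed
  then have "\<Sigma> \<le> (\<Sum>g\<in>TT - T. 2 * card D)"
    unfolding \<Sigma>_def by (intro sum_mono) simp
  then have "\<Sigma> \<le> card D * (card D * (2 * r))"
    by (simp add: card_R algebra_simps)
  then have "card D * (card D * ((p - 1) * r)) \<le> card D * (card D * (2 * r)) + card D * (card D * (p - 1))"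
    using count by linarith
  then have "card D * (card D * ((p - 1) * r)) \<le> card D * (card D * (2 * r + (p - 1)))"
    by (simp only: distrib_left)
  then have upper: "(p - 1) * r \<le> 2 * r + (p - 1)"
    using n by simp
  have "card D * (card D * (p - 1)) \<le> card D * (card D * ((p - 1) * r))"
    using count by linarith
  then have "1 \<le> r"
    using n p by (cases r) auto
  have "p dvd r - 1"
  proof -
    have "r + (p - 1) = (r - 1) + p"
      using \<open>1 \<le> r\<close> p by simp
    then show ?thesis
      using s(2) \<open>s = r + (p - 1)\<close> by simp
  qed
  have "r = 1"
  proof (rule ccontr)
    assume "r \<noteq> 1"
    then have "p \<le> r - 1"
      using \<open>p dvd r - 1\<close> \<open>1 \<le> r\<close> by (intro dvd_imp_le) auto
    obtain q where q: "p = q + 5"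
      using p le_Suc_ex by (metis add.commute)
    have "q + 6 \<le> r"
      using \<open>p \<le> r - 1\<close> \<open>1 \<le> r\<close> q by simp
    then obtain m where m: "r = q + 6 + m"
      by (auto simp: le_iff_add)
    show False
      using upper unfolding q m by (simp add: algebra_simps)
  qed
  then have "\<Sigma> = 0"
    using count by simp
  then have zero: "card (misses g) = 0" if "g \<in> TT - T" for g
    using that finTT unfolding \<Sigma>_def by (simp add: sum_eq_0_iff)
  have "x \<otimes> y \<in> TT"
    unfolding TT_def using xy by blast
  show ?thesis
  proof (rule disjCI)
    assume "x \<otimes> y \<notin> Z"
    then have "misses (x \<otimes> y) \<noteq> {}"
      using T_mem xy by (auto simp: Z_def misses_def)
    then show "x \<otimes> y \<in> T"
      using zero[of "x \<otimes> y"] \<open>x \<otimes> y \<in> TT\<close> finite_misses by auto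
  qed
qed

end

section \<open>The prime three\<close>

locale frobenius_triples = frobenius_pairs G p D for G (structure) and p D +
  assumes p3: "p = 3"
begin

lemma T_cube:
  assumes "t \<in> T"
  shows "t \<otimes> (t \<otimes> t) = \<one>"
proof -
  obtain A where A: "A \<in> D" "t \<in> A"
    using assms by (rule TE)
  let ?A = "G\<lparr>carrier := A\<rparr>"
  interpret A: group ?A
    by (rule subgroup_imp_group[OF D_subgroup[OF A(1)]])
  have "t [^]\<^bsub>?A\<^esub> order ?A = \<one>"
    using A.pow_order_eq_1[of t] A(2) by simp
  moreover have "order ?A = Suc (Suc (Suc 0))"
    using D_card[OF A(1)] p3 by (simp add: order_def numeral_3_eq_3)
  ultimately show ?thesis
    using T_mem[OF assms] by (simp add: m_assoc)
qed

lemma T_square: "t \<in> T \<Longrightarrow> t \<otimes> t = inv t"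
  using T_cube[of t] T_mem[of t] by (metis inv_equality m_closed r_inv inv_comm)

lemma D_elements:
  assumes A: "A \<in> D" and y: "y \<in> A" "y \<noteq> \<one>"
  shows "A = {\<one>, y, inv y}" and "y \<noteq> inv y"
proof -
  have yT: "y \<in> T"
    by (rule D_T[OF A y])
  show ne: "y \<noteq> inv y"
    using T_square[OF yT] T_mem[OF yT] y(2) by (metis l_cancel_one)
  have "{\<one>, y, inv y} \<subseteq> A"
    using D_one[OF A] D_closed(1)[OF A] y by blast
  moreover have "card {\<one>, y, inv y} = card A"
  proof -
    have "\<one> \<noteq> y" "\<one> \<noteq> inv y"
      using y(2) T_inv[OF yT] one_notin_T by auto
    then show ?thesis
      using D_card[OF A] p3 ne by simp
  qed
  ultimately show "A = {\<one>, y, inv y}"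
    using card_subset_eq[OF D_finite[OF A]] by metis
qed

text \<open>
The three elements of the coset of \<open>f\<close> are \<open>f\<close>, \<open>f y\<close> and \<open>f y\<^sup>-\<^sup>1\<close>, and exactly one of them is outside \<open>T\<close>.
\<close>
lemma dichotomy:
  assumes f: "f \<in> T" and y: "y \<in> T"
  shows "f \<otimes> y \<in> T \<longleftrightarrow> f \<otimes> inv y \<notin> T"
proof -
  obtain A where A: "A \<in> D" "y \<in> A" "y \<noteq> \<one>"
    using y by (rule TE)
  obtain t where t: "t \<in> A" "f \<otimes> t \<notin> T" and unique: "\<And>s. s \<in> A \<Longrightarrow> f \<otimes> s \<notin> T \<Longrightarrow> s = t"
    using coset_meets_T[OF f A(1)] by blast
  have "f \<otimes> \<one> \<in> T"
    using f T_mem[OF f] by simp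
  then have "t = y \<or> t = inv y"
    using t D_elements(1)[OF A] by auto
  then show ?thesis
    using t(2) unique[OF A(2)] unique[OF D_closed(1)[OF A(1,2)]] D_elements(2)[OF A] by auto
qed

lemma dichotomy_left:
  assumes f: "f \<in> T" and y: "y \<in> T"
  shows "y \<otimes> f \<in> T \<longleftrightarrow> inv y \<otimes> f \<notin> T"
  using dichotomy[OF assms] T_commute T_mem[OF f] T_mem[OF y] by auto

lemma conj_by_T: "x \<in> carrier G \<Longrightarrow> v \<in> carrier G \<Longrightarrow> conj_by x v \<in> T \<longleftrightarrow> v \<in> T"
  unfolding conj_by_def by (rule T_conj_iff(2))

lemma conj_by_inv_base:
  assumes x: "x \<in> T" and v: "v \<in> carrier G"
  shows "conj_by (inv x) v = conj_by x (conj_by x v)" and "conj_by x (conj_by x (conj_by x v)) = v"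
proof -
  have G: "x \<in> carrier G"
    using T_mem[OF x] .
  have "conj_by x (conj_by x v) = (x \<otimes> x) \<otimes> v \<otimes> inv (x \<otimes> x)"
    using G v by (simp add: conj_by_def group_word)
  then show eq: "conj_by (inv x) v = conj_by x (conj_by x v)"
    using T_square[OF x] G by (simp add: conj_by_def)
  show "conj_by x (conj_by x (conj_by x v)) = v"
    unfolding eq[symmetric] using G v by (simp add: conj_by_def group_word)
qed

text \<open>
This is the equation \<open>(v x)\<^sup>3 = \<one>\<close>, rewritten with \<open>x\<^sup>3 = \<one>\<close>.
\<close>
lemma orbit_product:
  assumes x: "x \<in> T" and v: "v \<in> carrier G" and xv: "x \<otimes> v \<in> T"
  shows "v \<otimes> (conj_by x v \<otimes> conj_by x (conj_by x v)) = \<one>"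
proof -
  have G: "x \<in> carrier G"
    using T_mem[OF x] .
  have "v \<otimes> x \<in> T"
    using xv T_commute[OF G v] by simp
  then have "(v \<otimes> x) \<otimes> ((v \<otimes> x) \<otimes> (v \<otimes> x)) = \<one>"
    by (rule T_cube)
  moreover have "(v \<otimes> x) \<otimes> ((v \<otimes> x) \<otimes> (v \<otimes> x))
      = v \<otimes> (conj_by x v \<otimes> conj_by x (conj_by x v)) \<otimes> (x \<otimes> (x \<otimes> x))"
    using G v by (simp add: conj_by_def group_word)
  ultimately show ?thesis
    using T_cube[OF x] G v by simp
qed

text \<open>
An abelian subgroup of a Frobenius kernel that is normalized by the complement generated by \<open>x\<close>.
The members of \<open>D\<close> contained in \<open>\<langle>x\<rangle> V\<close> behave like the points of a line on which \<open>V\<close> acts by translations and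
\<open>x\<close> by a rotation around one of the points.
\<close>
definition translation_group where
  "translation_group x V \<longleftrightarrow> subgroup V G \<and> V \<inter> T = {} \<and> (\<forall>v\<in>V. x \<otimes> v \<in> T)
    \<and> (\<forall>v\<in>V. conj_by x v \<in> V) \<and> (\<forall>u\<in>V. \<forall>v\<in>V. u \<otimes> v = v \<otimes> u)"

lemma translation_groupD:
  assumes "translation_group x V"
  shows "subgroup V G" and "v \<in> V \<Longrightarrow> v \<notin> T" and "v \<in> V \<Longrightarrow> x \<otimes> v \<in> T"
    and "v \<in> V \<Longrightarrow> conj_by x v \<in> V" and "u \<in> V \<Longrightarrow> v \<in> V \<Longrightarrow> u \<otimes> v = v \<otimes> u"
    and "v \<in> V \<Longrightarrow> v \<in> carrier G" and "\<one> \<in> V" and "v \<in> V \<Longrightarrow> inv v \<in> V"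
    and "u \<in> V \<Longrightarrow> v \<in> V \<Longrightarrow> u \<otimes> v \<in> V"
  using assms subgroup.mem_carrier[of V G v] subgroup.one_closed[of V G] subgroup.m_inv_closed[of V G v]
    subgroup.m_closed[of V G u v]
  unfolding translation_group_def by auto

lemma translation_group_inv:
  assumes x: "x \<in> T" and V: "translation_group x V"
  shows "translation_group (inv x) V"
proof -
  note V' = translation_groupD[OF V]
  have "inv x \<otimes> v \<in> T" if v: "v \<in> V" for v
  proof -
    have "inv x \<otimes> (x \<otimes> v) \<notin> T"
      using V'(2)[OF v] V'(6)[OF v] T_mem[OF x] by (simp add: group_word)
    then have "x \<otimes> (x \<otimes> v) \<in> T"
      using dichotomy_left[OF V'(3)[OF v] x] by simp
    then show ?thesis
      using T_square[OF x] V'(6)[OF v] T_mem[OF x] by (simp flip: m_assoc)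
  qed
  moreover have "conj_by (inv x) v \<in> V" if v: "v \<in> V" for v
    using conj_by_inv_base(1)[OF x V'(6)[OF v]] V'(4) v by simp
  ultimately show ?thesis
    using V unfolding translation_group_def by blast
qed

text \<open>
Every element \<open>s\<close> of the kernel for \<open>x\<close> lies in such a subgroup, namely the one generated by \<open>s\<close> and its conjugate
\<open>s\<^sub>1\<close> under \<open>x\<close>.  Let \<open>s\<^sub>2\<close> be the next conjugate.  Applied to \<open>x\<close> and to \<open>x\<^sup>-\<^sup>1\<close>, lemma \<open>orbit_product\<close> shows
\<open>s s\<^sub>1 s\<^sub>2 = s s\<^sub>2 s\<^sub>1 = \<one>\<close>, so the conjugates commute and \<open>s\<^sub>2\<close> is expressed by the other two.
\<close>
lemma translation_group_exist:
  assumes x: "x \<in> T" and s: "s \<in> carrier G" "s \<notin> T" "x \<otimes> s \<in> T"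
  obtains V where "translation_group x V" "s \<in> V"
proof -
  obtain A where A: "A \<in> D" "x \<in> A" "x \<noteq> \<one>"
    using x by (rule TE)
  obtain B where B: "B \<in> D" "x \<otimes> s \<in> B"
    using s(3) by (rule TE)
  obtain N where N: "subgroup N G" "N \<inter> T = {}"
    and norm: "\<And>a v. a \<in> A \<Longrightarrow> v \<in> N \<Longrightarrow> inv a \<otimes> v \<otimes> a \<in> N"
    and K: "\<And>k. k \<in> generate G (A \<union> B) \<Longrightarrow> \<exists>a\<in>A. a \<otimes> k \<in> N"
    and conj: "\<And>a v. a \<in> A \<Longrightarrow> a \<noteq> \<one> \<Longrightarrow> v \<in> N \<Longrightarrow> \<exists>w\<in>N. a \<otimes> v = inv w \<otimes> a \<otimes> w"
    using frobenius_kernel[OF A(1) B(1)] by metis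
  have xG: "x \<in> carrier G"
    using T_mem[OF x] .
  have NG: "v \<in> carrier G" if "v \<in> N" for v
    using subgroup.mem_carrier[OF N(1) that] .
  have AN_T: "a \<otimes> v \<in> T" if "a \<in> A" "a \<noteq> \<one>" "v \<in> N" for a v
    using conj[OF that] T_conj[OF D_T[OF A(1) that(1,2)]] NG by metis
  have xN: "x \<otimes> v \<in> T" "inv x \<otimes> v \<in> T" if "v \<in> N" for v
    using AN_T[OF A(2,3) that] AN_T[OF D_closed(1)[OF A(1,2)] _ that] A(3) xG by auto
  have conj_byN: "conj_by x v \<in> N" if "v \<in> N" for v
    using norm[OF D_closed(1)[OF A(1,2)] that] xG by (simp add: conj_by_def)
  have sN: "s \<in> N"
  proof -
    have "s = inv x \<otimes> (x \<otimes> s)"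
      using xG s(1) by (simp add: group_word)
    then have "s \<in> generate G (A \<union> B)"
      using A(2) B(2) by (metis UnI1 UnI2 generate.eng generate.incl generate.inv)
    then obtain a where a: "a \<in> A" "a \<otimes> s \<in> N"
      using K by blast
    have "inv a = \<one>"
    proof (rule ccontr)
      assume "inv a \<noteq> \<one>"
      then have "inv a \<otimes> (a \<otimes> s) \<in> T"
        using AN_T[OF D_closed(1)[OF A(1) a(1)] _ a(2)] by blast
      then show False
        using s D_mem[OF A(1) a(1)] by (simp add: group_word)
    qed
    then have "a = \<one>"
      using D_mem[OF A(1) a(1)] inv_eq_1_iff by blast
    then show ?thesis
      using a s(1) by simp
  qed
  let ?s1 = "conj_by x s" and ?s2 = "conj_by x (conj_by x s)"
  have G: "?s1 \<in> carrier G" "?s2 \<in> carrier G"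
    using xG s(1) by auto
  have prod: "s \<otimes> (?s1 \<otimes> ?s2) = \<one>"
    by (rule orbit_product[OF x s(1,3)])
  have "s \<otimes> (conj_by (inv x) s \<otimes> conj_by (inv x) (conj_by (inv x) s)) = \<one>"
    by (rule orbit_product[OF T_inv[OF x] s(1) xN(2)[OF sN]])
  then have "s \<otimes> (?s2 \<otimes> ?s1) = \<one>"
    using conj_by_inv_base[OF x] s(1) xG by simp
  then have "?s1 \<otimes> ?s2 = ?s2 \<otimes> ?s1"
    using prod G s(1) by (metis l_cancel m_closed)
  then have "conj_by x (s \<otimes> ?s1) = conj_by x (?s1 \<otimes> s)"
    using xG s(1) by (simp add: conj_by_mult)
  then have "conj_by x (conj_by x (conj_by x (s \<otimes> ?s1))) = conj_by x (conj_by x (conj_by x (?s1 \<otimes> s)))"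
    by simp
  then have comm: "s \<otimes> ?s1 = ?s1 \<otimes> s"
    using conj_by_inv_base(2)[OF x] G s(1) by simp
  define V where "V = generate G {s, ?s1}"
  have gen: "{s, ?s1} \<subseteq> carrier G"
    using s(1) G by simp
  have subV: "subgroup V G"
    unfolding V_def by (rule generate_is_subgroup[OF gen])
  have sV: "s \<in> V" "?s1 \<in> V"
    unfolding V_def by (auto intro: generate.incl)
  have VN: "V \<subseteq> N"
    unfolding V_def using sN conj_byN N(1) by (intro generate_subgroup_incl) auto
  have VG: "V \<subseteq> carrier G"
    using subgroup.subset[OF subV] .
  have "V \<subseteq> {g \<in> carrier G. \<forall>u\<in>{s, ?s1}. u \<otimes> g = g \<otimes> u}"
    unfolding V_def using comm gen
    by (intro generate_subgroup_incl centralizer_subgroup) auto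
  then have gens_central: "{s, ?s1} \<subseteq> {g \<in> carrier G. \<forall>u\<in>V. u \<otimes> g = g \<otimes> u}"
    using gen by fastforce
  have "V \<subseteq> {g \<in> carrier G. \<forall>u\<in>V. u \<otimes> g = g \<otimes> u}"
    using generate_subgroup_incl[OF gens_central centralizer_subgroup[OF VG]] unfolding V_def .
  then have abelian: "u \<otimes> v = v \<otimes> u" if "u \<in> V" "v \<in> V" for u v
    using that by blast
  have "?s2 = inv (s \<otimes> ?s1)"
    using prod s(1) G by (metis inv_equality inv_comm m_assoc m_closed)
  then have "?s2 \<in> V"
    using sV subgroup.m_closed[OF subV] subgroup.m_inv_closed[OF subV] by simp
  moreover have "inv x \<otimes> conj_by x v \<otimes> x = v" if "v \<in> carrier G" for v
    using that xG by (simp add: conj_by_def group_word)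
  ultimately have "{s, ?s1} \<subseteq> (\<lambda>a. inv x \<otimes> a \<otimes> x) ` V"
    using sV s(1) G by (metis (no_types, lifting) empty_subsetI image_eqI insert_subset)
  then have "V \<subseteq> (\<lambda>a. inv x \<otimes> a \<otimes> x) ` V"
    using generate_subgroup_incl[OF _ conjugate_subgroup[OF subV xG]] unfolding V_def by blast
  then have "conj_by x v \<in> V" if v: "v \<in> V" for v
  proof -
    obtain a where a: "a \<in> V" "v = inv x \<otimes> a \<otimes> x"
      using \<open>V \<subseteq> (\<lambda>a. inv x \<otimes> a \<otimes> x) ` V\<close> v by blast
    then have "conj_by x v = a"
      using xG VG by (auto simp: conj_by_def group_word)
    then show ?thesis
      using a by simp
  qed
  then have "translation_group x V"
    unfolding translation_group_def using subV VN N(2) xN(1) abelian by blast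
  then show thesis
    using that sV by blast
qed

text \<open>
Both sides are equivalent, by the dichotomy, to the same element \<open>z u x r\<^sup>-\<^sup>1 x\<close> lying outside \<open>T\<close>: once as an
alternative to \<open>z u r\<close>, and once with \<open>z x\<close> in place of \<open>z u x\<close>.
\<close>
lemma translation_shift_right:
  assumes x: "x \<in> T" and V: "translation_group x V" and z: "z \<in> T" "z \<otimes> x \<in> T"
    and u: "u \<in> V" "z \<otimes> u \<otimes> x \<in> T" and r: "r \<in> V"
  shows "z \<otimes> u \<otimes> r \<in> T \<longleftrightarrow> z \<otimes> r \<otimes> inv (conj_by x (conj_by x u)) \<in> T"
proof -
  note V' = translation_groupD[OF V]
  have G: "x \<in> carrier G" "z \<in> carrier G" "u \<in> carrier G" "r \<in> carrier G"
    using T_mem x z V'(6) u r by auto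
  have X: "inv x \<otimes> v \<in> T" if "v \<in> V" for v
    using translation_groupD(3)[OF translation_group_inv[OF x V] that] .
  define r' where "r' = r \<otimes> inv (conj_by x (conj_by x u))"
  have r': "r' \<in> V" "r' \<in> carrier G"
    using V'(4,6,8,9) u r by (auto simp: r'_def)
  have r'_eq: "r' = r \<otimes> inv (inv x \<otimes> u \<otimes> x)"
    unfolding r'_def conj_by_inv_base(1)[OF x G(3), symmetric] using G by (simp add: conj_by_def)
  have "z \<otimes> u \<otimes> x \<otimes> (inv x \<otimes> r) \<in> T \<longleftrightarrow> z \<otimes> u \<otimes> x \<otimes> inv (inv x \<otimes> r) \<notin> T"
    by (rule dichotomy[OF u(2) X[OF r]])
  moreover have "z \<otimes> x \<otimes> (inv x \<otimes> r') \<in> T \<longleftrightarrow> z \<otimes> x \<otimes> inv (inv x \<otimes> r') \<notin> T"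
    by (rule dichotomy[OF z(2) X[OF r'(1)]])
  moreover have "z \<otimes> x \<otimes> inv (inv x \<otimes> r') = z \<otimes> u \<otimes> x \<otimes> inv (inv x \<otimes> r)"
    unfolding r'_eq using G by (simp add: group_word)
  moreover have "z \<otimes> u \<otimes> x \<otimes> (inv x \<otimes> r) = z \<otimes> u \<otimes> r" "z \<otimes> x \<otimes> (inv x \<otimes> r') = z \<otimes> r'"
    using G r'(2) by (simp_all add: group_word)
  moreover have "z \<otimes> r' = z \<otimes> r \<otimes> inv (conj_by x (conj_by x u))"
    unfolding r'_def using G by (simp add: m_assoc)
  ultimately show ?thesis
    by metis
qed

text \<open>
The same comparison as in the preceding lemma, now through the element \<open>z v x\<^sup>-\<^sup>1 r\<^sup>-\<^sup>1\<close>.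
\<close>
lemma translation_shift_left:
  assumes x: "x \<in> T" and V: "translation_group x V" and z: "z \<in> T"
    and v: "v \<in> V" "z \<otimes> v \<in> T" and r: "r \<in> V"
  shows "z \<otimes> v \<otimes> r \<otimes> x \<in> T \<longleftrightarrow> z \<otimes> r \<otimes> inv (conj_by x v) \<otimes> x \<in> T"
proof -
  note V' = translation_groupD[OF V]
  have G: "x \<in> carrier G" "z \<in> carrier G" "v \<in> carrier G" "r \<in> carrier G"
    using T_mem x z V'(6) v r by auto
  have X: "s \<otimes> x \<in> T" if "s \<in> V" for s
    using T_commute[OF V'(6)[OF that] G(1)] V'(3)[OF that] by blast
  define r' where "r' = r \<otimes> inv (conj_by x v)"
  have r': "r' \<in> V" "r' \<in> carrier G"
    using V'(4,6,8,9) v r by (auto simp: r'_def)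
  have "z \<otimes> v \<otimes> (r \<otimes> x) \<in> T \<longleftrightarrow> z \<otimes> v \<otimes> inv (r \<otimes> x) \<notin> T"
    by (rule dichotomy[OF v(2) X[OF r]])
  moreover have "z \<otimes> (r' \<otimes> x) \<in> T \<longleftrightarrow> z \<otimes> inv (r' \<otimes> x) \<notin> T"
    by (rule dichotomy[OF z X[OF r'(1)]])
  moreover have "z \<otimes> inv (r' \<otimes> x) = z \<otimes> v \<otimes> inv (r \<otimes> x)"
    unfolding r'_def using G by (simp add: conj_by_def group_word)
  moreover have "z \<otimes> v \<otimes> (r \<otimes> x) = z \<otimes> v \<otimes> r \<otimes> x"
    using G by (simp add: m_assoc)
  moreover have "z \<otimes> (r' \<otimes> x) = z \<otimes> r \<otimes> inv (conj_by x v) \<otimes> x"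
    unfolding r'_def using G by (simp add: m_assoc)
  ultimately show ?thesis
    by metis
qed

lemma V_triple:
  assumes x: "x \<in> T" and V: "translation_group x V" and v: "v \<in> V"
  shows "v \<otimes> conj_by x v = inv (conj_by x (conj_by x v))"
proof -
  note V' = translation_groupD[OF V]
  have G: "x \<in> carrier G" "v \<in> carrier G" "conj_by x v \<in> carrier G" "conj_by x (conj_by x v) \<in> carrier G"
    using T_mem x V'(4,6) v by auto
  have "v \<otimes> (conj_by x v \<otimes> conj_by x (conj_by x v)) = \<one>"
    by (rule orbit_product[OF x G(2) V'(3)[OF v]])
  then have "(v \<otimes> conj_by x v) \<otimes> conj_by x (conj_by x v) = \<one>"
    using G by (simp add: m_assoc)
  then show ?thesis
    using G by (metis inv_equality m_closed)
qed

text \<open>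
Write \<open>\<phi>\<close> for conjugation by \<open>x\<close>, \<open>L\<^sub>0 = {v \<in> V. z v \<in> T}\<close> and \<open>L\<^sub>1 = {v \<in> V. z v x \<in> T}\<close>; both contain \<open>\<one>\<close>.  The two shift
lemmas say that \<open>v \<in> L\<^sub>0\<close> makes \<open>L\<^sub>1\<close> invariant under multiplication by \<open>v \<phi>(v) = \<phi>\<^sup>2(v)\<^sup>-\<^sup>1\<close>, and symmetrically that elements of \<open>L\<^sub>1\<close>
make \<open>L\<^sub>0\<close> invariant.  Going from \<open>L\<^sub>0\<close> to \<open>L\<^sub>1\<close> and back returns multiplication by \<open>v\<close> itself.
\<close>
lemma stabilizer_quotient_aux:
  assumes x: "x \<in> T" and V: "translation_group x V" and z: "z \<in> T" "z \<otimes> x \<in> T"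
    and v: "v \<in> V" "z \<otimes> v \<in> T"
  shows "z \<otimes> inv (conj_by x (conj_by x v)) \<otimes> x \<in> T"
    and "w \<in> V \<Longrightarrow> z \<otimes> w \<in> T \<Longrightarrow> z \<otimes> w \<otimes> inv v \<in> T"
proof -
  note V' = translation_groupD[OF V]
  have G: "x \<in> carrier G" "z \<in> carrier G" "v \<in> carrier G" "conj_by x v \<in> carrier G" "conj_by x (conj_by x v) \<in> carrier G"
    using T_mem x z V'(4,6) v by auto
  have "z \<otimes> v \<otimes> conj_by x v \<otimes> x \<in> T \<longleftrightarrow> z \<otimes> conj_by x v \<otimes> inv (conj_by x v) \<otimes> x \<in> T"
    by (rule translation_shift_left[OF x V z(1) v V'(4)[OF v(1)]])
  moreover have "z \<otimes> conj_by x v \<otimes> inv (conj_by x v) \<otimes> x = z \<otimes> x"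
    using G by (simp add: group_word)
  moreover have "z \<otimes> v \<otimes> conj_by x v \<otimes> x = z \<otimes> inv (conj_by x (conj_by x v)) \<otimes> x"
    using V_triple[OF x V v(1)] G by (simp add: m_assoc)
  ultimately show *: "z \<otimes> inv (conj_by x (conj_by x v)) \<otimes> x \<in> T"
    using z(2) by simp
  assume w: "w \<in> V" "z \<otimes> w \<in> T"
  have wG: "w \<in> carrier G"
    using V'(6) w by blast
  let ?u = "inv (conj_by x (conj_by x v))" and ?r = "conj_by x (conj_by x v) \<otimes> w"
  have u: "?u \<in> V" "?r \<in> V"
    using V'(4,8,9) v w by auto
  have cc: "conj_by x (conj_by x ?u) = inv (conj_by x v)"
    using G conj_by_inv_base(2)[OF x G(3)] by (simp add: conj_by_inv)
  have "z \<otimes> ?u \<otimes> ?r \<in> T \<longleftrightarrow> z \<otimes> ?r \<otimes> inv (conj_by x (conj_by x ?u)) \<in> T"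
    by (rule translation_shift_right[OF x V z u(1) * u(2)])
  moreover have "z \<otimes> ?u \<otimes> ?r = z \<otimes> w"
    using G wG by (simp add: group_word)
  moreover have "z \<otimes> ?r \<otimes> inv (conj_by x (conj_by x ?u)) = z \<otimes> w \<otimes> inv v"
  proof -
    have "conj_by x (conj_by x v) = inv (v \<otimes> conj_by x v)"
      using V_triple[OF x V v(1)] G by simp
    also have "v \<otimes> conj_by x v = conj_by x v \<otimes> v"
      using V'(5) V'(4) v(1) by blast
    finally have c2: "conj_by x (conj_by x v) = inv v \<otimes> inv (conj_by x v)"
      using G by (simp add: inv_mult_group)
    have "?r \<otimes> conj_by x v = w \<otimes> conj_by x (conj_by x v) \<otimes> conj_by x v"
      using V'(5)[OF w(1) V'(4)[OF V'(4)[OF v(1)]]] by simp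
    also have "\<dots> = w \<otimes> inv v"
      unfolding c2 using G wG by (simp add: group_word)
    finally show ?thesis
      unfolding cc using G wG by (simp add: m_assoc)
  qed
  ultimately show "z \<otimes> w \<otimes> inv v \<in> T"
    using w(2) by simp
qed

lemma neighbour_cases:
  assumes "x \<in> T" "z \<in> T"
  obtains "z \<otimes> x \<in> T" "z \<otimes> inv x \<notin> T" | "z \<otimes> inv x \<in> T" "z \<otimes> x \<notin> T"
  using dichotomy[OF assms(2,1)] by blast

text \<open>
Since exactly one of \<open>z x\<close> and \<open>z x\<^sup>-\<^sup>1\<close> is in \<open>T\<close>, the auxiliary lemma applies to \<open>x\<close> or to \<open>x\<^sup>-\<^sup>1\<close>.
\<close>
lemma stabilizer_quotient:
  assumes x: "x \<in> T" and V: "translation_group x V" and z: "z \<in> T"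
    and v: "v \<in> V" "z \<otimes> v \<in> T" and w: "w \<in> V" "z \<otimes> w \<in> T"
  shows "z \<otimes> w \<otimes> inv v \<in> T"
  using x z
proof (cases rule: neighbour_cases)
  case 1
  then show ?thesis
    using stabilizer_quotient_aux(2)[OF x V z _ v w] by blast
next
  case 2
  then show ?thesis
    using stabilizer_quotient_aux(2)[OF T_inv[OF x] translation_group_inv[OF x V] z _ v w] by blast
qed

lemma stabilizer_inverse:
  assumes x: "x \<in> T" and V: "translation_group x V" and z: "z \<in> T" and v: "v \<in> V"
  shows "z \<otimes> inv v \<in> T \<longleftrightarrow> z \<otimes> v \<in> T"
proof -
  note V' = translation_groupD[OF V]
  have *: "z \<otimes> inv v \<in> T" if "z \<otimes> v \<in> T" "v \<in> V" for v
    using stabilizer_quotient[OF x V z that(2,1) V'(7)] z T_mem[OF z] by simp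
  show ?thesis
    using *[OF _ v] *[OF _ V'(8)[OF v]] inv_inv[OF V'(6)[OF v]] by auto
qed

text \<open>
In the notation of lemma \<open>stabilizer_quotient_aux\<close>, this says \<open>\<phi>(L\<^sub>1) = L\<^sub>0\<close>.
\<close>
lemma rotate_stabilizer:
  assumes x: "x \<in> T" and V: "translation_group x V" and z: "z \<in> T" "z \<otimes> x \<in> T" and u: "u \<in> V"
  shows "z \<otimes> u \<otimes> x \<in> T \<longleftrightarrow> z \<otimes> conj_by x u \<in> T"
proof
  note V' = translation_groupD[OF V]
  have G: "x \<in> carrier G" "z \<in> carrier G" "u \<in> carrier G" "conj_by x u \<in> carrier G" "conj_by x (conj_by x u) \<in> carrier G"
    using T_mem x z V'(4,6) u by auto
  {
    assume ux: "z \<otimes> u \<otimes> x \<in> T"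
    have "z \<otimes> u \<otimes> conj_by x (conj_by x u) \<in> T \<longleftrightarrow> z \<otimes> conj_by x (conj_by x u) \<otimes> inv (conj_by x (conj_by x u)) \<in> T"
      by (rule translation_shift_right[OF x V z u ux V'(4)[OF V'(4)[OF u]]])
    moreover have "z \<otimes> conj_by x (conj_by x u) \<otimes> inv (conj_by x (conj_by x u)) = z"
      using G by (simp add: m_assoc)
    moreover have "z \<otimes> u \<otimes> conj_by x (conj_by x u) = z \<otimes> inv (conj_by x u)"
    proof -
      have "u \<otimes> conj_by x (conj_by x u) = conj_by x (conj_by x u) \<otimes> conj_by x (conj_by x (conj_by x u))"
        using conj_by_inv_base(2)[OF x G(3)] V'(5)[OF u V'(4)[OF V'(4)[OF u]]] by simp
      also have "\<dots> = inv (conj_by x (conj_by x (conj_by x (conj_by x u))))"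
        by (rule V_triple[OF x V V'(4)[OF V'(4)[OF u]]])
      also have "\<dots> = inv (conj_by x u)"
        using conj_by_inv_base(2)[OF x G(4)] by simp
      finally show ?thesis
        using G by (simp add: m_assoc)
    qed
    ultimately show "z \<otimes> conj_by x u \<in> T"
      using z(1) stabilizer_inverse[OF x V z(1) V'(4)[OF u]] by simp
  next
    assume "z \<otimes> conj_by x u \<in> T"
    then have "z \<otimes> inv (conj_by x u) \<in> T"
      using stabilizer_inverse[OF x V z(1) V'(4)[OF u]] by simp
    then have "z \<otimes> inv (conj_by x (conj_by x (inv (conj_by x u)))) \<otimes> x \<in> T"
      using stabilizer_quotient_aux(1)[OF x V z V'(8)[OF V'(4)[OF u]]] by blast
    then show "z \<otimes> u \<otimes> x \<in> T"
      using G conj_by_inv_base(2)[OF x G(3)] by (simp add: conj_by_inv)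
  }
qed

text \<open>
By the dichotomy, \<open>{v \<in> V. z v x\<^sup>-\<^sup>1 \<in> T}\<close> is the image of the complement of \<open>L\<^sub>0 = {v \<in> V. z v \<in> T}\<close>.  Based at one of its
own points it is, up to conjugation by \<open>x\<close>, again a subgroup, by lemma \<open>stabilizer_quotient\<close> for \<open>z\<^sub>1 = z \<phi>(u)\<^sup>-\<^sup>1 x\<^sup>-\<^sup>1\<close>,
where \<open>\<phi>\<close> is conjugation by \<open>x\<close>.  So the
complement of \<open>L\<^sub>0\<close> is empty or a coset of a subgroup, and in the latter case \<open>L\<^sub>0\<close> has index two.
\<close>
lemma stabilizer_index_aux:
  assumes x: "x \<in> T" and V: "translation_group x V" and z: "z \<in> T" "z \<otimes> x \<in> T"
    and u: "u \<in> V" "z \<otimes> u \<notin> T" and w: "w \<in> V" "z \<otimes> w \<notin> T"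
  shows "z \<otimes> u \<otimes> w \<in> T"
proof (rule ccontr)
  assume contra: "z \<otimes> u \<otimes> w \<notin> T"
  note V' = translation_groupD[OF V]
  have G: "x \<in> carrier G" "z \<in> carrier G" "u \<in> carrier G" "w \<in> carrier G"
    using T_mem x z V'(6) u w by auto
  have other: "z \<otimes> inv (conj_by x k) \<otimes> inv x \<in> T \<longleftrightarrow> z \<otimes> k \<notin> T" if k: "k \<in> V" for k
  proof -
    let ?r = "conj_by x (conj_by x k)"
    have kG: "k \<in> carrier G" and r: "?r \<in> V" "?r \<in> carrier G"
      using V'(4,6) k by auto
    have "?r \<otimes> x \<in> T"
      using T_commute[OF r(2) G(1)] V'(3)[OF r(1)] by blast
    then have "z \<otimes> (?r \<otimes> x) \<in> T \<longleftrightarrow> z \<otimes> inv (?r \<otimes> x) \<notin> T"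
      by (rule dichotomy[OF z(1)])
    moreover have "z \<otimes> (?r \<otimes> x) \<in> T \<longleftrightarrow> z \<otimes> k \<in> T"
      using rotate_stabilizer[OF x V z r(1)] conj_by_inv_base(2)[OF x kG] G r by (simp add: m_assoc)
    moreover have "inv (?r \<otimes> x) = inv (conj_by x k) \<otimes> inv x"
      using G kG by (simp add: conj_by_def group_word)
    ultimately show ?thesis
      using G kG by (simp add: m_assoc)
  qed
  define z1 where "z1 = z \<otimes> inv (conj_by x u) \<otimes> inv x"
  have z1: "z1 \<in> T"
    using other[OF u(1)] u(2) by (simp add: z1_def)
  have z1_iff: "z1 \<otimes> conj_by x (conj_by x b) \<in> T \<longleftrightarrow> z \<otimes> u \<otimes> inv b \<notin> T" if b: "b \<in> V" for b
  proof -
    have bG: "b \<in> carrier G"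
      using V'(6) b .
    have "inv x \<otimes> conj_by x (conj_by x b) = conj_by x b \<otimes> inv x"
      using G bG by (simp add: conj_by_def group_word)
    then have "z1 \<otimes> conj_by x (conj_by x b) = z \<otimes> inv (conj_by x u) \<otimes> conj_by x b \<otimes> inv x"
      unfolding z1_def using G bG by (simp add: m_assoc)
    also have "\<dots> = z \<otimes> (conj_by x b \<otimes> inv (conj_by x u)) \<otimes> inv x"
      using V'(5)[OF V'(8)[OF V'(4)[OF u(1)]] V'(4)[OF b]] G bG by (simp add: m_assoc)
    also have "conj_by x b \<otimes> inv (conj_by x u) = inv (conj_by x (u \<otimes> inv b))"
      using G bG by (simp add: conj_by_mult conj_by_inv inv_mult_group)
    finally show ?thesis
      using other[of "u \<otimes> inv b"] V'(8,9) u b G bG by (simp add: m_assoc)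
  qed
  have "z \<otimes> inv w \<notin> T"
    using stabilizer_inverse[OF x V z(1) w(1)] w(2) by simp
  moreover have "z \<otimes> u \<otimes> inv (w \<otimes> u) = z \<otimes> inv w"
    using G by (simp add: group_word)
  ultimately have b2: "z1 \<otimes> conj_by x (conj_by x (w \<otimes> u)) \<in> T"
    using z1_iff[of "w \<otimes> u"] V'(9) u w by simp
  have b1: "z1 \<otimes> conj_by x (conj_by x (inv w)) \<in> T"
    using z1_iff[of "inv w"] V'(8) w contra G by simp
  have "z1 \<otimes> conj_by x (conj_by x w) \<in> T"
    using b1 stabilizer_inverse[OF x V z1 V'(4)[OF V'(4)[OF w(1)]]] G by (simp add: conj_by_inv)
  then have "z1 \<otimes> conj_by x (conj_by x (w \<otimes> u)) \<otimes> inv (conj_by x (conj_by x w)) \<in> T"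
    by (rule stabilizer_quotient[OF x V z1 V'(4)[OF V'(4)[OF w(1)]] _
          V'(4)[OF V'(4)[OF V'(9)[OF w(1) u(1)]]] b2])
  moreover have "conj_by x (conj_by x (w \<otimes> u)) = conj_by x (conj_by x u) \<otimes> conj_by x (conj_by x w)"
    using V'(5)[OF w(1) u(1)] G by (simp add: conj_by_mult)
  ultimately have "z1 \<otimes> conj_by x (conj_by x u) \<in> T"
    using G T_mem[OF z1] by (simp add: m_assoc)
  then show False
    using z1_iff[OF u(1)] z(1) G by (simp add: m_assoc)
qed

lemma stabilizer_homomorphism:
  assumes x: "x \<in> T" and V: "translation_group x V" and z: "z \<in> T" and u: "u \<in> V" and v: "v \<in> V"
  shows "z \<otimes> (u \<otimes> v) \<in> T \<longleftrightarrow> (z \<otimes> u \<in> T \<longleftrightarrow> z \<otimes> v \<in> T)"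
proof -
  note V' = translation_groupD[OF V]
  have G: "z \<in> carrier G" "u \<in> carrier G" "v \<in> carrier G"
    using T_mem z V'(6) u v by auto
  have both: "z \<otimes> (a \<otimes> b) \<in> T" if "a \<in> V" "b \<in> V" "z \<otimes> a \<in> T" "z \<otimes> b \<in> T" for a b
  proof -
    have "z \<otimes> a \<otimes> inv (inv b) \<in> T"
      using stabilizer_quotient[OF x V z V'(8)[OF that(2)] _ that(1,3)]
        stabilizer_inverse[OF x V z that(2)] that(4) by blast
    then show ?thesis
      using G V'(6) that by (simp add: m_assoc)
  qed
  have cancel: "z \<otimes> b \<in> T" if "a \<in> V" "b \<in> V" "z \<otimes> a \<in> T" "z \<otimes> (a \<otimes> b) \<in> T" for a b
  proof -
    have "z \<otimes> (inv a \<otimes> (a \<otimes> b)) \<in> T"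
      using both[OF V'(8)[OF that(1)] V'(9)[OF that(1,2)] _ that(4)]
        stabilizer_inverse[OF x V z that(1)] that(3) by blast
    then show ?thesis
      using V'(6) that by (simp add: group_word)
  qed
  have neither: "z \<otimes> (u \<otimes> v) \<in> T" if "z \<otimes> u \<notin> T" "z \<otimes> v \<notin> T"
    using x z
  proof (cases rule: neighbour_cases)
    case 1
    then show ?thesis
      using stabilizer_index_aux[OF x V z _ u that(1) v that(2)] G by (simp add: m_assoc)
  next
    case 2
    then show ?thesis
      using stabilizer_index_aux[OF T_inv[OF x] translation_group_inv[OF x V] z _ u that(1) v that(2)] G
      by (simp add: m_assoc)
  qed
  have "u \<otimes> v = v \<otimes> u"
    by (rule V'(5)[OF u v])
  then show ?thesis
    using both[OF u v] cancel[OF u v] cancel[OF v u] neither by auto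
qed

text \<open>
A subgroup of index at most two contains all squares.
\<close>
lemma squares_in_Z:
  assumes x: "x \<in> T" and s: "s \<in> carrier G" "s \<notin> T" "x \<otimes> s \<in> T"
  shows "s \<otimes> s \<in> Z"
proof -
  obtain V where V: "translation_group x V" "s \<in> V"
    using translation_group_exist[OF x s] .
  have "s \<otimes> s \<otimes> z \<in> T" if z: "z \<in> T" for z
    using stabilizer_homomorphism[OF x V(1) z V(2,2)] T_commute[OF T_mem[OF z], of "s \<otimes> s"] s by simp
  then show ?thesis
    using s by (simp add: Z_def)
qed

text \<open>
Transports the index-two statement about \<open>z = t x \<in> T\<close> to elements \<open>t\<close> outside \<open>T\<close>, where membership of
\<open>t u\<close> in \<open>T\<close> becomes symmetric in \<open>t\<close> and \<open>u\<close>.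
\<close>
lemma pairing_via_stabilizer:
  assumes x: "x \<in> T" and V: "translation_group x V" and u: "u \<in> V"
    and t: "t \<in> carrier G" "t \<notin> T" "t \<otimes> x \<in> T"
  shows "t \<otimes> u \<notin> T \<longleftrightarrow> t \<otimes> x \<otimes> conj_by x u \<in> T"
proof -
  note V' = translation_groupD[OF V]
  have G: "x \<in> carrier G" "u \<in> carrier G"
    using T_mem x V'(6) u by auto
  have "t \<otimes> x \<otimes> x \<in> T"
    using dichotomy[OF t(3) x] t G by (simp add: m_assoc)
  then have rot: "t \<otimes> x \<otimes> inv u \<otimes> x \<in> T \<longleftrightarrow> t \<otimes> x \<otimes> conj_by x (inv u) \<in> T"
    using rotate_stabilizer[OF x V t(3) _ V'(8)[OF u]] by blast
  have "inv u \<otimes> x \<in> T"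
    using T_commute[of "inv u" x] V'(3)[OF V'(8)[OF u]] G by simp
  then have "t \<otimes> x \<otimes> (inv u \<otimes> x) \<in> T \<longleftrightarrow> t \<otimes> x \<otimes> inv (inv u \<otimes> x) \<notin> T"
    by (rule dichotomy[OF t(3)])
  moreover have "t \<otimes> x \<otimes> inv (inv u \<otimes> x) = t \<otimes> u"
    using G t(1) by (simp add: group_word)
  ultimately show ?thesis
    using rot stabilizer_inverse[OF x V t(3) V'(4)[OF u]] G t(1) by (simp add: m_assoc conj_by_inv)
qed

lemma pairing_right:
  assumes x: "x \<in> T" and V: "translation_group x V" and W: "translation_group x W"
    and t: "t \<in> W" and u: "u \<in> V" and v: "v \<in> V"
  shows "t \<otimes> (u \<otimes> v) \<in> T \<longleftrightarrow> (t \<otimes> u \<in> T) \<noteq> (t \<otimes> v \<in> T)"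
proof -
  note V' = translation_groupD[OF V] and W' = translation_groupD[OF W]
  have G: "x \<in> carrier G" "u \<in> carrier G" "v \<in> carrier G" "t \<in> carrier G"
    using T_mem x V'(6) u v W'(6) t by auto
  have tx: "t \<otimes> x \<in> T"
    using T_commute[OF G(4,1)] W'(3)[OF t] by simp
  note iff = pairing_via_stabilizer[OF x V _ G(4) W'(2)[OF t] tx]
  have "t \<otimes> (u \<otimes> v) \<notin> T \<longleftrightarrow> t \<otimes> x \<otimes> (conj_by x u \<otimes> conj_by x v) \<in> T"
    using iff[OF V'(9)[OF u v]] G by (simp add: conj_by_mult)
  also have "\<dots> \<longleftrightarrow> (t \<otimes> x \<otimes> conj_by x u \<in> T \<longleftrightarrow> t \<otimes> x \<otimes> conj_by x v \<in> T)"
    by (rule stabilizer_homomorphism[OF x V tx V'(4)[OF u] V'(4)[OF v]])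
  finally show ?thesis
    using iff[OF u] iff[OF v] by blast
qed

lemma pairing_left:
  assumes x: "x \<in> T" and V: "translation_group x V" and W: "translation_group x W"
    and t: "t \<in> W" "s \<in> W" and u: "u \<in> V"
  shows "(t \<otimes> s) \<otimes> u \<in> T \<longleftrightarrow> (t \<otimes> u \<in> T) \<noteq> (s \<otimes> u \<in> T)"
  using pairing_right[OF x W V u t] T_commute translation_groupD(6)[OF V u]
    translation_groupD(6)[OF W t(1)] translation_groupD(6)[OF W t(2)] by simp

text \<open>
Bilinearity and \<open>v \<phi>(v) \<phi>\<^sup>2(v) = \<one>\<close>, where \<open>\<phi>\<close> is conjugation by \<open>x\<close>, force a nonzero pairing into one shape: there is a conjugate \<open>a\<close> of
\<open>u\<close> such that \<open>b = t\<close> pairs trivially with \<open>a\<close> and nontrivially with \<open>a\<^sub>1 = \<phi>(a)\<close> and \<open>\<phi>\<^sup>2(a)\<close>.  By invariance \<open>b\<^sub>1 = \<phi>(b)\<close>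
pairs trivially with \<open>a\<^sub>1\<close> and nontrivially with \<open>a\<close>.  So \<open>w\<^sub>1 = a b\<^sub>1\<close> and \<open>w\<^sub>2 = a\<^sub>1 b\<close> are in \<open>T\<close>.  Neither \<open>w\<^sub>1 w\<^sub>2\<close> nor
\<open>w\<^sub>1 w\<^sub>2\<^sup>-\<^sup>1\<close> is, because up to conjugation and squares in \<open>Z\<close> they pair a quotient of \<open>b\<close> and \<open>b\<^sub>1\<close> with a quotient of \<open>a\<close>
and \<open>a\<^sub>1\<close>, on which the pairing vanishes.  This contradicts the dichotomy.
\<close>
lemma pairing_trivial:
  assumes x: "x \<in> T" and V: "translation_group x V" and W: "translation_group x W"
    and t: "t \<in> W" and u: "u \<in> V"
  shows "t \<otimes> u \<notin> T"
proof
  assume tu: "t \<otimes> u \<in> T"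
  note V' = translation_groupD[OF V] and W' = translation_groupD[OF W]
  have xG: "x \<in> carrier G"
    using T_mem[OF x] .
  have turn: "conj_by x s \<otimes> conj_by x v \<in> T \<longleftrightarrow> s \<otimes> v \<in> T" if "s \<in> W" "v \<in> V" for s v
    using conj_by_T[OF xG, of "s \<otimes> v"] conj_by_mult[OF xG] V'(6) W'(6) that by simp
  have sum0: "\<not> ((t \<otimes> v \<in> T) \<noteq> ((t \<otimes> conj_by x v \<in> T) \<noteq> (t \<otimes> conj_by x (conj_by x v) \<in> T)))" if v: "v \<in> V" for v
  proof -
    have "t \<otimes> (v \<otimes> (conj_by x v \<otimes> conj_by x (conj_by x v))) \<notin> T"
      using orbit_product[OF x V'(6)[OF v] V'(3)[OF v]] W'(2,6)[OF t] by simp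
    then show ?thesis
      using pairing_right[OF x V W t v, of "conj_by x v \<otimes> conj_by x (conj_by x v)"]
        pairing_right[OF x V W t, of "conj_by x v" "conj_by x (conj_by x v)"] V'(4,9) v by simp
  qed
  obtain a where a: "a \<in> V" "t \<otimes> a \<notin> T" "t \<otimes> conj_by x a \<in> T"
  proof (cases "t \<otimes> conj_by x u \<in> T")
    case True
    then have "t \<otimes> conj_by x (conj_by x u) \<notin> T"
      using sum0[OF u] tu by simp
    then show ?thesis
      using that[of "conj_by x (conj_by x u)"] conj_by_inv_base(2)[OF x V'(6)[OF u]] tu V'(4) u by simp
  next
    case False
    then show ?thesis
      using that[of "conj_by x u"] sum0[OF u] tu V'(4) u by simp
  qed
  define a1 b b1 where "a1 = conj_by x a" and "b = t" and "b1 = conj_by x t"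
  have mem: "a \<in> V" "a1 \<in> V" "b \<in> W" "b1 \<in> W"
    using a t V'(4) W'(4) by (auto simp: a1_def b_def b1_def)
  have G: "a \<in> carrier G" "a1 \<in> carrier G" "b \<in> carrier G" "b1 \<in> carrier G"
    using mem V'(6) W'(6) by auto
  have "t \<otimes> conj_by x (conj_by x a) \<in> T"
    using sum0[OF a(1)] a(2,3) by simp
  then have ba: "b \<otimes> a \<notin> T" "b \<otimes> a1 \<in> T" "b1 \<otimes> a1 \<notin> T" "b1 \<otimes> a \<in> T"
    using a turn[OF t a(1)] turn[OF t V'(4)[OF V'(4)[OF a(1)]]] conj_by_inv_base(2)[OF x V'(6)[OF a(1)]]
    by (auto simp: a1_def b_def b1_def)
  have diag: "(d \<otimes> e) \<otimes> (f \<otimes> g) \<notin> T"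
    if "d \<in> W" "e \<in> W" "f \<in> V" "g \<in> V"
      "((d \<otimes> f \<in> T) \<noteq> (d \<otimes> g \<in> T)) = ((e \<otimes> f \<in> T) \<noteq> (e \<otimes> g \<in> T))" for d e f g
    using pairing_left[OF x V W that(1,2) V'(9)[OF that(3,4)]] pairing_right[OF x V W that(1,3,4)]
      pairing_right[OF x V W that(2,3,4)] that(5) by simp
  have inv_right: "d \<otimes> inv f \<in> T \<longleftrightarrow> d \<otimes> f \<in> T" if "d \<in> W" "f \<in> V" for d f
    using pairing_right[OF x V W that(1,2) V'(8)[OF that(2)]] V'(6)[OF that(2)] W'(2,6)[OF that(1)] by auto
  have inv_left: "inv d \<otimes> f \<in> T \<longleftrightarrow> d \<otimes> f \<in> T" if "d \<in> W" "f \<in> V" for d f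
    using pairing_left[OF x V W that(1) W'(8)[OF that(1)] that(2)] W'(6)[OF that(1)] V'(2,6)[OF that(2)] by auto
  define w1 w2 where "w1 = a \<otimes> b1" and "w2 = a1 \<otimes> b"
  have w: "w1 \<in> T" "w2 \<in> T"
    unfolding w1_def w2_def using ba T_commute G by auto
  have "(b1 \<otimes> inv b) \<otimes> (inv a1 \<otimes> a) \<notin> T"
    using mem W'(8) V'(8) ba by (intro diag) (simp_all add: inv_left inv_right)
  then have "w1 \<otimes> inv w2 \<notin> T"
    using T_commute[of a "b1 \<otimes> inv b \<otimes> inv a1"] G by (simp add: w1_def w2_def group_word)
  then have "w1 \<otimes> w2 \<in> T"
    using dichotomy[OF w] by blast
  define s where "s = b1 \<otimes> a1"
  have sG: "s \<in> carrier G"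
    using G by (simp add: s_def)
  \<comment> \<open>\<open>s\<close> lies outside \<open>T\<close> and is a product of two elements of \<open>T\<close>, so its square stabilizes \<open>T\<close>;
    modulo \<open>Z\<close>, the middle factor \<open>s\<close> of \<open>w1 \<otimes> w2 = a \<otimes> s \<otimes> b\<close> can be replaced by \<open>inv s\<close>\<close>
  have "b1 \<otimes> inv x \<in> T"
    using translation_groupD(3)[OF translation_group_inv[OF x W] mem(4)] T_commute[of b1 "inv x"] G xG by simp
  then have y: "inv (b1 \<otimes> inv x) \<in> T"
    by (rule T_inv)
  have "inv (b1 \<otimes> inv x) \<otimes> s = x \<otimes> a1"
    using G xG by (simp add: s_def group_word)
  then have "s \<otimes> s \<in> Z"
    using squares_in_Z[OF y sG] ba(3) V'(3)[OF mem(2)] by (simp add: s_def)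
  then have Zs: "inv (inv b \<otimes> (s \<otimes> s) \<otimes> b) \<in> Z"
    using subgroup.m_inv_closed[OF Z_subgroup Z_conj(1)] G(3) by blast
  have "w1 \<otimes> w2 \<otimes> inv (inv b \<otimes> (s \<otimes> s) \<otimes> b) = a \<otimes> (inv a1 \<otimes> inv b1 \<otimes> b)"
    using G by (simp add: w1_def w2_def s_def group_word)
  then have "a \<otimes> (inv a1 \<otimes> inv b1 \<otimes> b) \<in> T"
    using Z_right[OF Zs \<open>w1 \<otimes> w2 \<in> T\<close>] by simp
  then have "(inv b1 \<otimes> b) \<otimes> (a \<otimes> inv a1) \<in> T"
    using T_commute[of "a \<otimes> inv a1" "inv b1 \<otimes> b"] G by (simp add: m_assoc)
  moreover have "(inv b1 \<otimes> b) \<otimes> (a \<otimes> inv a1) \<notin> T"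
    using mem W'(8) V'(8) ba by (intro diag) (simp_all add: inv_left inv_right)
  ultimately show False
    by blast
qed

text \<open>
\<open>t = z x\<^sup>-\<^sup>1\<close> lies in a translation group for \<open>x\<close> as well, so triviality of the pairing applies to it.
\<close>
lemma stabilizer_everything:
  assumes x: "x \<in> T" and V: "translation_group x V" and s: "s \<in> V"
    and z: "z \<in> T" "z \<otimes> inv x \<notin> T"
  shows "z \<otimes> s \<in> T"
proof -
  note V' = translation_groupD[OF V]
  have G: "x \<in> carrier G" "z \<in> carrier G" "s \<in> carrier G"
    using T_mem x z V'(6) s by auto
  define t where "t = z \<otimes> inv x"
  have tx: "t \<otimes> x = z"
    using G by (simp add: t_def m_assoc)
  have t: "t \<in> carrier G" "t \<notin> T" "t \<otimes> x \<in> T"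
    using G z tx by (simp_all add: t_def)
  then have "x \<otimes> t \<in> T"
    using T_commute G by blast
  then obtain W where W: "translation_group x W" "t \<in> W"
    using translation_group_exist[OF x t(1,2)] by blast
  have "t \<otimes> conj_by x (conj_by x s) \<notin> T"
    by (rule pairing_trivial[OF x V W V'(4)[OF V'(4)[OF s]]])
  then show ?thesis
    using pairing_via_stabilizer[OF x V V'(4)[OF V'(4)[OF s]] t] conj_by_inv_base(2)[OF x G(3)] tx by simp
qed

lemma products_three:
  assumes xy: "x \<in> T" "y \<in> T"
  shows "x \<otimes> y \<in> T \<or> x \<otimes> y \<in> Z"
proof (cases "x \<otimes> y \<in> T")
  case s: False
  have G: "x \<in> carrier G" "y \<in> carrier G" "x \<otimes> y \<in> carrier G"
    using T_mem xy by auto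
  have x': "inv x \<in> T"
    using T_inv xy by blast
  have "inv x \<otimes> (x \<otimes> y) \<in> T"
    using G xy by (simp add: group_word)
  then obtain V where V: "translation_group (inv x) V" "x \<otimes> y \<in> V"
    using translation_group_exist[OF x' G(3) s] by blast
  have "x \<otimes> y \<otimes> z \<in> T" if z: "z \<in> T" for z
  proof -
    have "z \<otimes> (x \<otimes> y) \<in> T"
      using x' z
    proof (cases rule: neighbour_cases)
      case 1
      then show ?thesis
        using stabilizer_everything[OF x' V z] by blast
    next
      case 2
      then show ?thesis
        using stabilizer_everything[OF T_inv[OF x'] translation_group_inv[OF x' V(1)] V(2) z] G by simp
    qed
    then show ?thesis
      using T_commute[OF T_mem[OF z] G(3)] by simp
  qed
  then show ?thesis
    using G by (simp add: Z_def)
qed simp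

end

section \<open>The normal closure of a subgroup of prime order\<close>

theorem theorem2:
  fixes G (structure) and p :: nat and H :: "'a set"
  assumes "group G" and "finite (carrier G)"
    and "Factorial_Ring.prime p" and "odd p" and "p dvd order G"
    and "subgroup H G" and "cyclic_group (G\<lparr>carrier := H\<rparr>)" and "card H = p"
    and "\<And>g. g \<in> carrier G \<Longrightarrow> generate G (H \<union> conjugate G H g) \<inter> normalizer G H = H"
  shows "normal_closure G H \<inter> normalizer G H = H
         \<and> carrier G = normalizer G H <#> p_prime_core p G"
proof -
  interpret group G by fact
  note H = \<open>subgroup H G\<close> and pair = assms(9)
  have HG: "H \<subseteq> carrier G"
    by (rule subgroup.subset[OF H])
  define D where "D = conjugate G H ` carrier G"
  have D_iff: "A \<in> D \<longleftrightarrow> (\<exists>g\<in>carrier G. A = (\<lambda>a. inv g \<otimes> a \<otimes> g) ` H)" for A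
    by (auto simp: D_def conjugate_eq_image)
  interpret frobenius_pairs G p D
  proof (rule frobenius_pairs.intro[OF group_axioms], rule frobenius_pairs_axioms.intro)
    show "finite (carrier G)" "Factorial_Ring.prime p"
      by fact+
  next
    fix A assume "A \<in> D"
    then obtain g where g: "g \<in> carrier G" "A = (\<lambda>a. inv g \<otimes> a \<otimes> g) ` H"
      using D_iff by blast
    show "subgroup A G"
      unfolding g(2) by (rule conjugate_subgroup[OF H g(1)])
    have "inj_on (\<lambda>a. inv g \<otimes> a \<otimes> g) H"
      using g(1) HG by (intro inj_onI) (auto simp: subset_iff)
    then show "card A = p"
      unfolding g(2) using card_image \<open>card H = p\<close> by blast
  next
    fix A k assume "A \<in> D" and k: "k \<in> carrier G"
    then obtain g where g: "g \<in> carrier G" "A = (\<lambda>a. inv g \<otimes> a \<otimes> g) ` H"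
      using D_iff by blast
    then have "(\<lambda>a. inv k \<otimes> a \<otimes> k) ` A = (\<lambda>a. inv (g \<otimes> k) \<otimes> a \<otimes> (g \<otimes> k)) ` H"
      using conjugate_image_mult[OF HG g(1) k] by simp
    then show "(\<lambda>a. inv k \<otimes> a \<otimes> k) ` A \<in> D"
      using D_iff g(1) k by blast
  next
    fix A B k
    assume "A \<in> D" "B \<in> D" and k: "k \<in> generate G (A \<union> B)" and norm: "(\<lambda>a. inv k \<otimes> a \<otimes> k) ` A = A"
    then obtain a b where a: "a \<in> carrier G" "A = (\<lambda>x. inv a \<otimes> x \<otimes> a) ` H"
      and b: "b \<in> carrier G" "B = (\<lambda>x. inv b \<otimes> x \<otimes> b) ` H"
      using D_iff by metis
    have ba: "b \<otimes> inv a \<in> carrier G"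
      using a b by simp
    \<comment> \<open>conjugation by \<open>inv a\<close> moves the pair \<open>A, B\<close> to \<open>H\<close> and a conjugate of \<open>H\<close>\<close>
    define K where "K = generate G (H \<union> conjugate G H (b \<otimes> inv a))"
    have "conjugate G H (b \<otimes> inv a) \<subseteq> carrier G"
      unfolding conjugate_eq_image using subgroup.subset[OF conjugate_subgroup[OF H ba]] .
    then have K: "subgroup K G"
      unfolding K_def using HG by (intro generate_is_subgroup) blast
    have HK: "H \<subseteq> K" "conjugate G H (b \<otimes> inv a) \<subseteq> K"
      unfolding K_def by (auto intro: generate.incl)
    have "A \<subseteq> (\<lambda>x. inv a \<otimes> x \<otimes> a) ` K"
      unfolding a(2) using HK(1) by (rule image_mono)
    moreover have "B = (\<lambda>x. inv a \<otimes> x \<otimes> a) ` conjugate G H (b \<otimes> inv a)"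
    proof -
      have "b = b \<otimes> inv a \<otimes> a"
        using a b by (simp add: m_assoc)
      then show ?thesis
        unfolding conjugate_eq_image b(2) using conjugate_image_mult[OF HG ba a(1)] by metis
    qed
    then have "B \<subseteq> (\<lambda>x. inv a \<otimes> x \<otimes> a) ` K"
      using HK(2) by blast
    ultimately have "generate G (A \<union> B) \<subseteq> (\<lambda>x. inv a \<otimes> x \<otimes> a) ` K"
      using conjugate_subgroup[OF K a(1)] by (intro generate_subgroup_incl) auto
    then obtain c where c: "c \<in> K" "k = inv a \<otimes> c \<otimes> a"
      using k by blast
    have cG: "c \<in> carrier G"
      by (rule subgroup.mem_carrier[OF K c(1)])
    have ak: "a \<otimes> k = c \<otimes> a" and kG: "k \<in> carrier G"
      using c(2) a(1) cG by (simp_all add: group_word)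
    have "(\<lambda>x. inv (c \<otimes> a) \<otimes> x \<otimes> (c \<otimes> a)) ` H = (\<lambda>x. inv a \<otimes> x \<otimes> a) ` H"
      unfolding ak[symmetric] conjugate_image_mult[OF HG a(1) kG] using norm a(2) by simp
    then have "(\<lambda>x. inv a \<otimes> x \<otimes> a) ` ((\<lambda>x. inv c \<otimes> x \<otimes> c) ` H) = (\<lambda>x. inv a \<otimes> x \<otimes> a) ` H"
      using conjugate_image_mult[OF HG cG a(1)] by simp
    then have "(\<lambda>x. inv c \<otimes> x \<otimes> c) ` H = H"
      using conjugate_image_inv[OF HG a(1)]
        conjugate_image_inv[OF subgroup.subset[OF conjugate_subgroup[OF H cG]] a(1)] by simp
    then have "c \<in> K \<inter> normalizer G H"
      using c(1) cG normalizer_iff[OF HG] by blast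
    then have "c \<in> H"
      using pair[OF ba] unfolding K_def by blast
    then show "k \<in> A"
      using c(2) a(2) by blast
  qed
  have products: "x \<otimes> y \<in> T \<or> x \<otimes> y \<in> Z" if "x \<in> T" "y \<in> T" for x y
  proof (cases "p = 3")
    case True
    then interpret frobenius_triples G p D
      by unfold_locales
    show ?thesis
      by (rule products_three[OF that])
  next
    case False
    have "p \<noteq> 0" "p \<noteq> 1" "p \<noteq> 2" "p \<noteq> 4"
      using \<open>Factorial_Ring.prime p\<close> \<open>odd p\<close> by auto
    then show ?thesis
      using products_large_prime[OF _ that] False by fastforce
  qed
  have conj_one: "(\<lambda>a. inv \<one> \<otimes> a \<otimes> \<one>) ` H = H"
  proof -
    have "(\<lambda>a. inv \<one> \<otimes> a \<otimes> \<one>) ` H = (\<lambda>a. a) ` H"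
      using HG by (intro image_cong) auto
    then show ?thesis
      by simp
  qed
  then have HD: "H \<in> D"
    using D_iff one_closed by metis
  have H_normalizer: "H \<subseteq> normalizer G H"
    using pair[OF one_closed] by blast
  have "H \<subseteq> normal_closure G H"
    unfolding normal_closure_def using HD unfolding D_def by (auto intro: generate.incl)
  moreover have "normal_closure G H \<subseteq> Z <#> H"
    unfolding normal_closure_def
  proof (rule generate_subgroup_incl[OF _ mult_norm_subgroup[OF Z_normal H]])
    show "(\<Union>g\<in>carrier G. conjugate G H g) \<subseteq> Z <#> H"
    proof
      fix b assume "b \<in> (\<Union>g\<in>carrier G. conjugate G H g)"
      then obtain B where B: "B \<in> D" "b \<in> B"
        by (auto simp: D_def)
      obtain z a where "z \<in> Z" "a \<in> H" "b = z \<otimes> a"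
        using D_subset_Z_mult[OF products HD B] .
      then show "b \<in> Z <#> H"
        by (auto simp: set_mult_def)
    qed
  qed
  moreover have "g \<in> H" if g: "g \<in> Z <#> H" "g \<in> normalizer G H" for g
  proof -
    obtain z a where za: "z \<in> Z" "a \<in> H" "g = z \<otimes> a"
      using g(1) by (auto simp: set_mult_def)
    have "z = \<one>"
      using normalizer_in_Z_mult[OF products HD za(1,2)] g(2) normalizer_iff[OF HG] za(3) by blast
    then show ?thesis
      using za HG by auto
  qed
  ultimately have "normal_closure G H \<inter> normalizer G H = H"
    using H_normalizer by blast
  moreover have "carrier G = normalizer G H <#> p_prime_core p G"
  proof
    have "Z \<subseteq> p_prime_core p G"
      using p_prime_core_max[OF fin p_prime Z_normal p_not_dvd_card_Z] HD by blast
    then have core: "w \<in> p_prime_core p G" if "w \<in> Z" for w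
      using that by blast
    show "carrier G \<subseteq> normalizer G H <#> p_prime_core p G"
    proof
      fix g assume g: "g \<in> carrier G"
      obtain w where w: "w \<in> Z" "(\<lambda>a. inv g \<otimes> a \<otimes> g) ` H = (\<lambda>a. inv w \<otimes> a \<otimes> w) ` H"
        using conjugate_by_Z[OF products HD g] .
      have wG: "w \<in> carrier G"
        by (rule ZD(1)[OF w(1)])
      have "(\<lambda>a. inv (g \<otimes> inv w) \<otimes> a \<otimes> (g \<otimes> inv w)) ` H = H"
        unfolding conjugate_image_mult[OF HG g inv_closed[OF wG]] w(2) by (rule conjugate_image_inv[OF HG wG])
      then have "g \<otimes> inv w \<in> normalizer G H"
        using normalizer_iff[OF HG] g wG by simp
      moreover have "g = g \<otimes> inv w \<otimes> w"
        using g wG by (simp add: m_assoc)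
      ultimately show "g \<in> normalizer G H <#> p_prime_core p G"
        unfolding set_mult_def using core[OF w(1)] by blast
    qed
    show "normalizer G H <#> p_prime_core p G \<subseteq> carrier G"
      using subgroup.subset[OF normalizer_imp_subgroup[OF HG]]
        subgroup.subset[OF normal_imp_subgroup[OF p_prime_core_normal[OF fin p_prime]]]
      by (rule set_mult_closed)
  qed
  ultimately show ?thesis
    by blast
qed

end
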